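(* Let $(N,\mathcal B;\pi,\bar\pi)$ be a Type $\mathscr A_1$ rank $2$ Bäcklund transformation whose relative invariants satisfy $C_2,D_4,K\ne0$ and $S_i=0$ $(i=1,\dots,4)$, with canonical coframing on $N$, invariants $H_1,\dots,H_4$ and canonical structure equations (S1), (S2) as given in the context. This Bäcklund transformation is of (1) cohomogeneity $2$ if and only if either $\{H_2=1,\ H_3=-1\}$ or $\{H_2=\epsilon (H_1)^2,\ H_4=-\epsilon\}$; (2) cohomogeneity $3$ if and only if $$\epsilon(3H_2H_3+H_3+4H_2)\big((H_1)^2-\epsilon H_2\big)=-\big(\epsilon H_2+3(H_1)^2\big)(H_4+\epsilon)(H_2-1)$$ and it is not of cohomogeneity $2$; (3) cohomogeneity $4$ if and only if it is not of cohomogeneity $2$ or $3$.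
   Context: EDS $(M,\mathcal I)$: $\mathcal I\subset\Omega^*(M)$ an ideal closed under $\mathrm d$; $\langle\cdots\rangle_{\rm alg}$ = algebraic ideal generated, $[\![\cdots]\!]$ = bundle spanned; $I^1$ = bundle spanned by degree 1 part of $\mathcal I$. A rank $k$ integrable extension is a submersion $\pi:(N,\mathcal J)\to(M,\mathcal I)$ with $k$-dimensional fibres such that locally there is a rank $k$ subbundle $\Theta\subset T^*N$ with $\mathcal J$ algebraically generated by $\pi^*\mathcal I$ and sections of $\Theta$, and $\Theta^\perp\cap\ker\pi_*=0$. A rank $r$ Bäcklund transformation $(N,\mathcal B;\pi,\bar\pi)$ relating $(M,\mathcal I)$, $(\bar M,\bar{\mathcal I})$: both $\pi,\bar\pi$ are rank $r$ integrable extensions. Hyperbolic Monge-Ampère system: EDS $(M^5,\mathcal I)$ locally generated by a contact form $\theta$, $\mathrm d\theta$ and a 2-form $\Phi$ such that $(\lambda\,\mathrm d\theta+\mu\Phi)^2\equiv0\bmod\theta$ has precisely two distinct solutions in $\mathbb{RP}^1$ at each point. Type $\mathscr A$: a rank 2 Bäcklund transformation relating two hyperbolic Monge-Ampère systems with (i) $\pi^*I^1\cap\bar\pi^*\bar I^1=0$; (ii) for local generators $\theta,\bar\theta$ of $\pi^*I^1,\bar\pi^*\bar I^1$ and $B^1=[\![\theta,\bar\theta,\gamma]\!]$, $\lambda\,\mathrm d\theta+\mu\,\mathrm d\bar\theta\equiv0\bmod\theta,\bar\theta,\gamma$ iff $\lambda=\mu=0$. The characteristic systems of $(N,\mathcal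 B)$ (ordered) are $\chi_{10}=[\![B^1,\omega^1,\omega^2]\!]$, $\chi_{01}=[\![B^1,\omega^3,\omega^4]\!]$ when $\mathcal B=\langle B^1,\omega^1\wedge\omega^2,\omega^3\wedge\omega^4\rangle_{\rm alg}$. Type $\mathscr A_1$: locally there are coframings $(\omega^0,\bar\omega^0,\gamma,\omega^1,\dots,\omega^4)$ (called 1-adapted) with $[\![\omega^0]\!]=\pi^*I^1$, $[\![\bar\omega^0]\!]=\bar\pi^*\bar I^1$, $[\![\omega^0,\bar\omega^0,\gamma]\!]=B^1$, $\chi_{10}=[\![\omega^0,\bar\omega^0,\gamma,\omega^1,\omega^2]\!]$, $\chi_{01}=[\![\omega^0,\bar\omega^0,\gamma,\omega^3,\omega^4]\!]$, and $\mathrm d\omega^0\equiv A\omega^1\wedge\omega^2+\omega^3\wedge(\omega^4+\gamma)\bmod\omega^0$, $\mathrm d\bar\omega^0\equiv\omega^1\wedge(\omega^2+\gamma)+\epsilon A\omega^3\wedge\omega^4\bmod\bar\omega^0$, $\mathrm d\gamma\equiv C_0\omega^0\wedge\bar\omega^0+C_i\omega^i\wedge\omega^0+D_i\omega^i\wedge\bar\omega^0\bmod\gamma$, with $\epsilon=\pm1$, $A>0$, $A^2\neq\epsilon$. The 1-adapted coframings are sections of a $G_1$-structure $\mathcal G_1$ ($\dim G_1=4$), whose tautological form satisfies $\mathrm d\omega^0=-(\alpha+\phi)\wedge\omega^0+\Omega^0$, $\mathrm d\bar\omega^0=-(\alpha+\phi)\wedge\bar\omega^0+\bar\Omega^0$,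 $\mathrm d\gamma=-\phi\wedge\gamma+\Gamma$, $\mathrm d\omega^1=-\alpha\wedge\omega^1+\Omega^1$, $\mathrm d\omega^2=-\beta_1\wedge\omega^1-\phi\wedge\omega^2+\Omega^2$, $\mathrm d\omega^3=-\alpha\wedge\omega^3+\Omega^3$, $\mathrm d\omega^4=-\beta_2\wedge\omega^3-\phi\wedge\omega^4+\Omega^4$, with $\Omega^0=A\omega^1\wedge\omega^2+\omega^3\wedge(\omega^4+\gamma)+(K\gamma+P_i\omega^i)\wedge\omega^0$, $\bar\Omega^0=\omega^1\wedge(\omega^2+\gamma)+\epsilon A\omega^3\wedge\omega^4-(K\gamma+P_i\omega^i)\wedge\bar\omega^0$, $\Gamma=C_0\omega^0\wedge\bar\omega^0+C_i\omega^i\wedge\omega^0+D_i\omega^i\wedge\bar\omega^0$. $S_i$ are defined by $\Omega^1\equiv S_1\omega^3\wedge(\omega^4+\gamma)$, $\Omega^2\equiv S_2\omega^3\wedge(\omega^4+\gamma)\bmod\omega^0,\omega^1,\omega^2$; $\Omega^3\equiv S_3\omega^1\wedge(\omega^2+\gamma)$, $\Omega^4\equiv S_4\omega^1\wedge(\omega^2+\gamma)\bmod\bar\omega^0,\omega^3,\omega^4$. Canonical coframing: when $C_2,D_4,K\ne0$ and $S_i=0$, there is a unique 1-adapted coframing with $D_4=K=1$, $C_1=D_3=0$. For it put $H_1=A$, $H_2=AC_2$, $H_3=AM_0$, $H_4=A\bar M_0/C_2$, where $M_0,\bar M_0$ are the coefficients of $\gamma\wedge\omega^0$ and $\gamma\wedge\bar\omega^0$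 in $\mathrm d\gamma$. Thus $H_1>0$, $(H_1)^2\neq\epsilon$, $H_2\ne0$. It satisfies the canonical structure equations: (S1) $\mathrm d\omega^0=\frac12\big(1-\frac{\epsilon H_2}{H_1^2}\big)\omega^0\wedge\bar\omega^0+(3\epsilon H_4-H_3+1)\omega^0\wedge\gamma+H_1\omega^1\wedge\omega^2-\frac12\big(H_2(\epsilon H_4-3H_3-3)-3\epsilon H_4+H_3-3\big)\omega^0\wedge\omega^2+\omega^3\wedge(\omega^4+\gamma)-\frac12\big(H_3-3\epsilon H_4+1+\frac{H_1^2(\epsilon H_3-3H_4-3\epsilon)}{H_2}\big)\omega^0\wedge\omega^4$; $\mathrm d\bar\omega^0=(3\epsilon H_4-H_3+3)\bar\omega^0\wedge(\omega^2+\gamma)+(\epsilon H_4+H_3+1)\bar\omega^0\wedge\omega^4+\omega^1\wedge(\omega^2+\gamma)+\epsilon H_1\omega^3\wedge\omega^4$; $\mathrm d\gamma=\frac1{H_1}(H_3\gamma+H_2\omega^2-\omega^4)\wedge\omega^0+\big(\frac{H_2H_4}{H_1^2}\gamma-\frac{\epsilon H_2}{H_1^2}\omega^2+\omega^4\big)\wedge\bar\omega^0+\big(\frac34+\frac{\epsilon H_2}{4H_1^2}\big)\omega^1\wedge\gamma+(3\epsilon H_4-H_3+3)(\epsilon H_4+1)\omega^2\wedge\gamma-\frac{3H_2+1}{4H_1}\omega^3\wedge\gamma+(\epsilon H_4-3H_3-3)(H_3+1)\omega^4\wedge\gamma$; $\mathrm d\omega^1=(3H_4^2-3H_3^2+8\epsilon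 H_4-6H_3+1)\omega^1\wedge\gamma+\frac{H_3+1}{H_1}\omega^0\wedge\omega^1+(3H_4^2-\epsilon H_3H_4+7\epsilon H_4+4)\omega^1\wedge\omega^2+\frac{H_2(H_4+\epsilon)}{H_1^2}\bar\omega^0\wedge\omega^1-(3H_3^2-\epsilon H_3H_4+5H_3-2\epsilon H_4+2)\omega^1\wedge\omega^4-\frac{3H_2+1}{4H_1}\omega^1\wedge\omega^3$; $\mathrm d\omega^2=-\frac1{H_1}\omega^0\wedge(\omega^4+\gamma)+\frac{H_2-H_3-1}{H_1}\omega^0\wedge\omega^2-\frac{H_2(H_4+\epsilon)}{H_1^2}\bar\omega^0\wedge\omega^2+\big(\frac34+\frac{\epsilon H_2}{4H_1^2}\big)\omega^1\wedge\omega^2+(3H_3^2-3H_4^2+7H_3-7\epsilon H_4)\omega^2\wedge\gamma+\frac{3H_2+1}{4H_1}\omega^2\wedge\omega^3-(\epsilon H_4-3H_3-3)(H_3+1)\omega^2\wedge\omega^4$; $\mathrm d\omega^3=\frac{1+H_2+2H_3}{2H_1}\omega^0\wedge\omega^3+\big(-\frac12+\frac{H_2H_4}{H_1^2}+\frac{3\epsilon H_2}{2H_1^2}\big)\bar\omega^0\wedge\omega^3-\big(\frac34+\frac{\epsilon H_2}{4H_1^2}\big)\omega^1\wedge\omega^3+(3H_4^2+8\epsilon H_4-3H_3^2-6H_3+3)\omega^3\wedge\gamma+\frac12\big(\epsilon H_4(H_2+2H_3-6\epsilon H_4-15)-3H_2H_3-3H_2+3H_3-9\big)\omega^2\wedge\omega^3-\frac12\big(\frac{H_1^2(\epsilon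 H_3-3H_4-3\epsilon)}{H_2}+(3H_3-\epsilon H_4+3)(2H_3+1)\big)\omega^3\wedge\omega^4$; $\mathrm d\omega^4=-\frac{H_3+1}{H_1}\omega^0\wedge\omega^4-\frac{\epsilon H_2}{H_1^2}\bar\omega^0\wedge(\omega^2+\gamma)+\big(1-\frac{H_2(H_4+\epsilon)}{H_1^2}\big)\bar\omega^0\wedge\omega^4+\big(\frac34+\frac{\epsilon H_2}{4H_1^2}\big)\omega^1\wedge\omega^4+(H_4+\epsilon)(3H_4-\epsilon H_3+3\epsilon)\omega^2\wedge\omega^4-\frac{3H_2+1}{4H_1}\omega^3\wedge\omega^4+(3H_3^2-3H_4^2+7H_3-7\epsilon H_4)\omega^4\wedge\gamma$. (S2) $\mathrm dH_1=-\frac12(H_2-1)\omega^0-\frac12\big(H_1-\frac{\epsilon H_2}{H_1}\big)\bar\omega^0+2H_1(H_3-\epsilon H_4)\gamma-\frac{H_1}2(\epsilon H_2H_4+3\epsilon H_4-3H_2H_3-3H_2-H_3+3)\omega^2-\frac{H_1}2\big(\frac{H_1^2}{H_2}(3H_4+3\epsilon-\epsilon H_3)+(\epsilon H_4-3H_3-3)\big)\omega^4$; $\mathrm dH_2=\frac{H_2(1-H_2)}{H_1}\omega^0+4H_2(H_3+1)(\omega^4+\gamma)-H_2(\epsilon H_2H_4-\epsilon H_4-3H_2H_3-3H_2-H_3-1)\omega^2$; $\mathrm dH_3=\frac{H_3(H_3+1)}{H_1}\omega^0+\frac{H_2(H_3+1)(H_4+\epsilon)}{H_1^2}\bar\omega^0-(6\epsilon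 H_4-3H_3^2+3H_4^2-4H_3+3)(H_3+1)\gamma-(H_3+1)\big(\frac34+\frac{\epsilon H_2}{4H_1^2}\big)\omega^1+\frac{3H_2H_3+4H_2+H_3}{4H_1}\omega^3-(H_3+1)(3H_4-\epsilon H_3+3\epsilon)(H_4+\epsilon)\omega^2-H_3(H_3+1)(\epsilon H_4-3H_3-3)\omega^4$; $\mathrm dH_4=\frac{(H_3+1)(H_4+\epsilon)}{H_1}\omega^0+\frac{H_2H_4(H_4+\epsilon)}{H_1^2}\bar\omega^0-(4\epsilon H_4-3H_3^2+3H_4^2-6H_3-3)(H_4+\epsilon)\gamma-\big(\frac{3H_4}4+\frac{\epsilon H_2H_4}{4H_1^2}+\epsilon\big)\omega^1-H_4(3\epsilon H_4-H_3+3)(\epsilon H_4+1)\omega^2+\frac{(H_4+\epsilon)(3H_2+1)}{4H_1}\omega^3-(H_3+1)(H_4+\epsilon)(\epsilon H_4-3H_3-3)\omega^4$. Cohomogeneity: the codimension in $N$ of the orbits of the local symmetries of the Bäcklund transformation; since the structure is an $\{e\}$-structure whose invariants are all functions of $(H_1,\dots,H_4)$, it equals the rank of the map $\Theta=(H_1,H_2,H_3,H_4):N\to\{h\in\mathbb R^4:h_1>0,\ h_1^2\ne\epsilon,\ h_2\neq0\}$. The equations on the $H_i$ in the claim are understood to hold identically on $N$ (local statement, $N$ connected). *)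

theory Defs
  imports "HOL-Analysis.Analysis"
begin

section \<open>Exterior algebra in coordinates\<close>

text \<open>
  An element of the full exterior algebra of the dual of \<open>real ^ 'm\<close> is given by its coefficients
  with respect to the basis \<open>dx\<^sub>S\<close>, where \<open>S\<close> is a set of indices and \<open>dx\<^sub>S\<close> is the wedge product of
  the \<open>dx\<^sub>i\<close>, \<open>i \<in> S\<close>, in increasing order.
\<close>

type_synonym 'm ext = "real ^ ('m set)"

text \<open>\<open>dx\<^sub>S\<close> wedge \<open>dx\<^sub>T\<close> equals \<open>koszul S T\<close> times \<open>dx\<close> indexed by \<open>S \<union> T\<close>, for disjoint \<open>S\<close>, \<open>T\<close>.\<close>

definition koszul :: "'m::{finite,linorder} set \<Rightarrow> 'm set \<Rightarrow> real" where
  "koszul S T = (-1) ^ card {(i, j). i \<in> S \<and> j \<in> T \<and> j < i}"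

definition wedge :: "'m::{finite,linorder} ext \<Rightarrow> 'm ext \<Rightarrow> 'm ext" (infixl "\<and>\<^sub>w" 76) where
  "a \<and>\<^sub>w b = (\<chi> S. \<Sum>T\<in>Pow S. koszul T (S - T) * (a $ T) * (b $ (S - T)))"

definition one_ext :: "'m::finite ext" where
  "one_ext = axis {} 1"

definition covec :: "real ^ 'm::finite \<Rightarrow> 'm ext" where
  "covec a = (\<Sum>j\<in>UNIV. (a $ j) *\<^sub>R axis {j} 1)"

text \<open>Evaluation of (the degree 1 part of) \<open>\<xi>\<close> on a tangent vector.\<close>

definition pairing :: "'m::finite ext \<Rightarrow> real ^ 'm \<Rightarrow> real" where
  "pairing \<xi> v = (\<Sum>j\<in>UNIV. \<xi> $ {j} * v $ j)"

definition homogeneous :: "nat \<Rightarrow> 'm::finite ext \<Rightarrow> bool" where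
  "homogeneous k \<xi> \<longleftrightarrow> (\<forall>S. card S \<noteq> k \<longrightarrow> \<xi> $ S = 0)"

definition degree_part :: "nat \<Rightarrow> 'm::finite ext \<Rightarrow> 'm ext" where
  "degree_part k \<xi> = (\<chi> S. if card S = k then \<xi> $ S else 0)"

text \<open>The algebra homomorphism induced by a linear map \<open>L\<close>; it sends \<open>dx\<^sub>t\<close> to the \<open>t\<close>-th row of \<open>L\<close>.\<close>

definition pull_ext :: "(real ^ 'a::{finite,linorder} \<Rightarrow> real ^ 'b::{finite,linorder}) \<Rightarrow> 'b ext \<Rightarrow>
    'a ext" where
  "pull_ext L \<xi> = (\<Sum>T\<in>UNIV. (\<xi> $ T) *\<^sub>R
     foldr (\<and>\<^sub>w) (map (\<lambda>t. covec (\<chi> j. L (axis j 1) $ t)) (sorted_list_of_set T)) one_ext)"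

text \<open>Congruence modulo the algebraic ideal generated by a set of 1-forms at a point.\<close>

definition cong_mod :: "'m::{finite,linorder} ext set \<Rightarrow> 'm ext \<Rightarrow> 'm ext \<Rightarrow> bool" where
  "cong_mod S a b \<longleftrightarrow> a - b \<in> span {c \<and>\<^sub>w s | c s. s \<in> S}"


section \<open>Smooth manifolds and differential forms\<close>

text \<open>Smoothness on an open set of a Euclidean space.\<close>

fun Ck_on :: "nat \<Rightarrow> 'a::real_normed_vector set \<Rightarrow> ('a \<Rightarrow> 'b::real_normed_vector) \<Rightarrow> bool" where
  "Ck_on 0 S f = continuous_on S f"
| "Ck_on (Suc k) S f = ((\<forall>x\<in>S. f differentiable (at x)) \<and>
     (\<forall>v. Ck_on k S (\<lambda>x. frechet_derivative f (at x) v)))"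

definition smooth_on :: "'a::real_normed_vector set \<Rightarrow> ('a \<Rightarrow> 'b::real_normed_vector) \<Rightarrow> bool" where
  "smooth_on S f \<longleftrightarrow> (\<forall>k. Ck_on k S f)"

text \<open>
  A manifold is a type \<open>'p\<close> of points with an atlas; a chart is a pair of its domain and its coordinate
  map.
\<close>

type_synonym ('p, 'm) chart = "'p set \<times> ('p \<Rightarrow> real ^ 'm)"

definition chart_inv :: "('p, 'm::finite) chart \<Rightarrow> real ^ 'm \<Rightarrow> 'p" where
  "chart_inv c = the_inv_into (fst c) (snd c)"

definition smooth_manifold ::
    "('p::{t2_space,second_countable_topology}, 'm::finite) chart set \<Rightarrow> bool" where
  "smooth_manifold A \<longleftrightarrow> (\<Union>c\<in>A. fst c) = UNIV \<and>
     (\<forall>c\<in>A. open (fst c) \<and> open (snd c ` fst c) \<and>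
        homeomorphism (fst c) (snd c ` fst c) (snd c) (chart_inv c)) \<and>
     (\<forall>c\<in>A. \<forall>c'\<in>A. smooth_on (snd c ` (fst c \<inter> fst c')) (snd c' \<circ> chart_inv c))"

text \<open>
  Objects on a manifold are given by their coordinate expressions in all charts of the atlas.
  A pair \<open>(c, x)\<close> stands for the point with coordinates \<open>x\<close> in the chart \<open>c\<close>; tangent vectors and
  covectors at \<open>(c, x)\<close> are expressed in the coordinates of \<open>c\<close>.
\<close>

type_synonym ('p, 'm) pt = "('p, 'm) chart \<times> (real ^ 'm)"

type_synonym ('p, 'm) form = "('p, 'm) pt \<Rightarrow> 'm ext"

definition base :: "('p, 'm::finite) pt \<Rightarrow> 'p" where
  "base z = chart_inv (fst z) (snd z)"

definition pts :: "('p, 'm::finite) chart set \<Rightarrow> 'p set \<Rightarrow> ('p, 'm) pt set" where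
  "pts A W = {(c, x). c \<in> A \<and> x \<in> snd c ` (fst c \<inter> W)}"

definition smooth_fun :: "('p, 'm::finite) chart set \<Rightarrow> ('p \<Rightarrow> real) \<Rightarrow> bool" where
  "smooth_fun A f \<longleftrightarrow> (\<forall>c\<in>A. smooth_on (snd c ` fst c) (f \<circ> chart_inv c))"

text \<open>
  The smooth (inhomogeneous) differential forms on the open set \<open>W\<close>. The second condition is the
  transformation rule under changes of charts. Values outside \<open>pts A W\<close> are irrelevant.
\<close>

definition forms :: "('p, 'm::{finite,linorder}) chart set \<Rightarrow> 'p set \<Rightarrow> ('p, 'm) form set" where
  "forms A W = {\<psi>.
     (\<forall>c\<in>A. \<forall>S. smooth_on (snd c ` (fst c \<inter> W)) (\<lambda>x. \<psi> (c, x) $ S)) \<and>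
     (\<forall>c\<in>A. \<forall>c'\<in>A. \<forall>x\<in>snd c ` (fst c \<inter> fst c' \<inter> W).
        \<psi> (c, x) = pull_ext (frechet_derivative (snd c' \<circ> chart_inv c) (at x))
                     (\<psi> (c', snd c' (chart_inv c x))))}"

definition kforms :: "('p, 'm::{finite,linorder}) chart set \<Rightarrow> 'p set \<Rightarrow> nat \<Rightarrow> ('p, 'm) form set" where
  "kforms A W k = {\<psi> \<in> forms A W. \<forall>z\<in>pts A W. homogeneous k (\<psi> z)}"

definition ext_d :: "('p, 'm::{finite,linorder}) form \<Rightarrow> ('p, 'm) form" where
  "ext_d \<psi> = (\<lambda>(c, x). \<chi> S. \<Sum>i\<in>S. koszul {i} (S - {i}) *
     frechet_derivative (\<lambda>y. \<psi> (c, y) $ (S - {i})) (at x) (axis i 1))"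

definition fun_form :: "('p \<Rightarrow> real) \<Rightarrow> ('p, 'm::{finite,linorder}) form" where
  "fun_form f = (\<lambda>z. f (base z) *\<^sub>R one_ext)"

subsection \<open>Smooth maps\<close>

definition chart_at :: "('p, 'm::finite) chart set \<Rightarrow> 'p \<Rightarrow> ('p, 'm) chart" where
  "chart_at A p = (SOME c. c \<in> A \<and> p \<in> fst c)"

definition smooth_map :: "('p::topological_space, 'a::finite) chart set \<Rightarrow>
    ('q::topological_space, 'b::finite) chart set \<Rightarrow> ('p \<Rightarrow> 'q) \<Rightarrow> bool" where
  "smooth_map A A' f \<longleftrightarrow> continuous_on UNIV f \<and>
     (\<forall>c\<in>A. \<forall>c'\<in>A'. smooth_on (snd c ` (fst c \<inter> f -` fst c')) (snd c' \<circ> f \<circ> chart_inv c))"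

text \<open>
  In the next three definitions, a chart of the target around the image point is chosen; what is
  derived from them does not depend on this choice.
\<close>

definition image_pt :: "('q, 'b::finite) chart set \<Rightarrow> ('p \<Rightarrow> 'q) \<Rightarrow> ('p, 'a::finite) pt \<Rightarrow> ('q, 'b) pt"
  where
  "image_pt A' f z = (let q = f (base z); c' = chart_at A' q in (c', snd c' q))"

definition dmap :: "('q, 'b::finite) chart set \<Rightarrow> ('p \<Rightarrow> 'q) \<Rightarrow> ('p, 'a::finite) pt \<Rightarrow>
    real ^ 'a \<Rightarrow> real ^ 'b" where
  "dmap A' f z = frechet_derivative (snd (fst (image_pt A' f z)) \<circ> f \<circ> chart_inv (fst z)) (at (snd z))"

definition pullback :: "('q, 'b::{finite,linorder}) chart set \<Rightarrow> ('p \<Rightarrow> 'q) \<Rightarrow> ('q, 'b) form \<Rightarrow>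
    ('p, 'a::{finite,linorder}) form" where
  "pullback A' f \<psi> z = pull_ext (dmap A' f z) (\<psi> (image_pt A' f z))"

definition submersion :: "('p::topological_space, 'a::finite) chart set \<Rightarrow>
    ('q::topological_space, 'b::finite) chart set \<Rightarrow> ('p \<Rightarrow> 'q) \<Rightarrow> bool" where
  "submersion A A' f \<longleftrightarrow> smooth_map A A' f \<and> (\<forall>z\<in>pts A UNIV. surj (dmap A' f z))"

definition map_rank :: "('p \<Rightarrow> 'v::euclidean_space) \<Rightarrow> ('p, 'm::finite) pt \<Rightarrow> nat" where
  "map_rank f z = dim (range (frechet_derivative (f \<circ> chart_inv (fst z)) (at (snd z))))"


section \<open>Exterior differential systems\<close>

text \<open>
  The algebraic ideal of the forms on \<open>W\<close> generated by the restrictions of the forms in \<open>G\<close>.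
  It is only applied to sets \<open>G\<close> of homogeneous forms and to graded ideals \<open>G\<close>, so that multiples
  from the left suffice. In particular, \<open>alg_ideal A W I\<close> is the restriction to \<open>W\<close> of an ideal \<open>I\<close>.
\<close>

definition alg_ideal :: "('p, 'm::{finite,linorder}) chart set \<Rightarrow> 'p set \<Rightarrow> ('p, 'm) form set \<Rightarrow>
    ('p, 'm) form set" where
  "alg_ideal A W G = {\<psi> \<in> forms A W. \<exists>F a. finite F \<and> F \<subseteq> G \<and> (\<forall>g\<in>F. a g \<in> forms A W) \<and>
     (\<forall>z\<in>pts A W. \<psi> z = (\<Sum>g\<in>F. a g z \<and>\<^sub>w g z))}"

definition EDS :: "('p::{t2_space,second_countable_topology}, 'm::{finite,linorder}) chart set \<Rightarrow>
    ('p, 'm) form set \<Rightarrow> bool" where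
  "EDS A I \<longleftrightarrow> smooth_manifold A \<and> I \<subseteq> forms A UNIV \<and> alg_ideal A UNIV I \<subseteq> I \<and>
     (\<forall>\<psi>\<in>I. \<forall>k. (\<lambda>z. degree_part k (\<psi> z)) \<in> I) \<and> (\<forall>\<psi>\<in>I. ext_d \<psi> \<in> I)"

text \<open>The fibre at \<open>z\<close> of the bundle spanned by the degree 1 part of an ideal, e.g.\ \<open>I\<^sup>1\<close>, \<open>B\<^sup>1\<close>.\<close>

definition deg1 :: "('p, 'm::{finite,linorder}) chart set \<Rightarrow> ('p, 'm) form set \<Rightarrow> ('p, 'm) pt \<Rightarrow>
    'm ext set" where
  "deg1 A I z = span {\<psi> z | \<psi>. \<psi> \<in> I \<inter> kforms A UNIV 1}"

definition pull_bundle :: "('q, 'b::{finite,linorder}) chart set \<Rightarrow> ('p \<Rightarrow> 'q) \<Rightarrow>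
    (('q, 'b) pt \<Rightarrow> 'b ext set) \<Rightarrow> ('p, 'a::{finite,linorder}) pt \<Rightarrow> 'a ext set" where
  "pull_bundle A' f E z = pull_ext (dmap A' f z) ` E (image_pt A' f z)"

definition sections :: "('p, 'm::{finite,linorder}) chart set \<Rightarrow> 'p set \<Rightarrow>
    (('p, 'm) pt \<Rightarrow> 'm ext set) \<Rightarrow> ('p, 'm) form set" where
  "sections A W E = {\<eta> \<in> kforms A W 1. \<forall>z\<in>pts A W. \<eta> z \<in> E z}"

text \<open>
  \<open>integrable_extension k AN J AM I \<pi>\<close>: the map \<open>\<pi>\<close> from \<open>(N, J)\<close> to \<open>(M, I)\<close> is a rank \<open>k\<close> integrable
  extension. The subbundle \<open>\<Theta>\<close> of the cotangent bundle is locally spanned by \<open>t 0, \<dots>, t (k - 1)\<close>.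
\<close>

definition integrable_extension :: "nat \<Rightarrow>
    ('p::{t2_space,second_countable_topology}, 'a::{finite,linorder}) chart set \<Rightarrow> ('p, 'a) form set \<Rightarrow>
    ('q::{t2_space,second_countable_topology}, 'b::{finite,linorder}) chart set \<Rightarrow> ('q, 'b) form set \<Rightarrow>
    ('p \<Rightarrow> 'q) \<Rightarrow> bool" where
  "integrable_extension k AN J AM I \<pi> \<longleftrightarrow> EDS AN J \<and> EDS AM I \<and> submersion AN AM \<pi> \<and>
     CARD('a) = CARD('b) + k \<and>
     (\<forall>p. \<exists>W t. open W \<and> p \<in> W \<and> (\<forall>i<k. t i \<in> kforms AN W 1) \<and>
        (let \<Theta> = (\<lambda>z. span ((\<lambda>i. t i z) ` {..<k})) in
           (\<forall>z\<in>pts AN W. dim (\<Theta> z) = k) \<and>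
           alg_ideal AN W J = alg_ideal AN W (pullback AM \<pi> ` I \<union> sections AN W \<Theta>) \<and>
           (\<forall>z\<in>pts AN W. \<forall>v. (\<forall>\<xi>\<in>\<Theta> z. pairing \<xi> v = 0) \<and> dmap AM \<pi> z v = 0 \<longrightarrow> v = 0)))"

text \<open>The set of solutions in the projective line is rendered as a set of lines in the plane.\<close>

definition hyperbolic_MA :: "('p::{t2_space,second_countable_topology}, 5) chart set \<Rightarrow>
    ('p, 5) form set \<Rightarrow> bool" where
  "hyperbolic_MA A I \<longleftrightarrow> EDS A I \<and>
     (\<forall>p. \<exists>W \<theta> \<Phi>. open W \<and> p \<in> W \<and> \<theta> \<in> kforms A W 1 \<and> \<Phi> \<in> kforms A W 2 \<and>
        (\<forall>z\<in>pts A W. \<theta> z \<and>\<^sub>w ext_d \<theta> z \<and>\<^sub>w ext_d \<theta> z \<noteq> 0) \<and>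
        alg_ideal A W I = alg_ideal A W {\<theta>, ext_d \<theta>, \<Phi>} \<and>
        (\<forall>z\<in>pts A W.
           card {span {(l, m)} | l m :: real. (l, m) \<noteq> (0, 0) \<and>
             (let \<psi> = l *\<^sub>R ext_d \<theta> z + m *\<^sub>R \<Phi> z in cong_mod {\<theta> z} (\<psi> \<and>\<^sub>w \<psi>) 0)} = 2))"


section \<open>Baecklund transformations\<close>

text \<open>The data \<open>(N, B; \<pi>, \<pi>b)\<close>, \<open>(M, I)\<close>, \<open>(Mb, Ib)\<close>; a trailing \<open>b\<close> stands for a bar.\<close>

record ('n, 'a, 'm, 'k, 'b) baecklund_data =
  AN :: "('n, 'a::finite) chart set"
  BN :: "('n, 'a) form set"
  AM :: "('m, 'b::finite) chart set"
  IM :: "('m, 'b) form set"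
  pr :: "'n \<Rightarrow> 'm"
  AMb :: "('k, 'b) chart set"
  IMb :: "('k, 'b) form set"
  prb :: "'n \<Rightarrow> 'k"

definition baecklund :: "nat \<Rightarrow>
    ('n::{t2_space,second_countable_topology}, 'a::{finite,linorder},
     'm::{t2_space,second_countable_topology}, 'k::{t2_space,second_countable_topology},
     'b::{finite,linorder}) baecklund_data \<Rightarrow> bool" where
  "baecklund r X \<longleftrightarrow> integrable_extension r (AN X) (BN X) (AM X) (IM X) (pr X) \<and>
     integrable_extension r (AN X) (BN X) (AMb X) (IMb X) (prb X)"

abbreviation pI1 :: "('n, 'a::{finite,linorder}, 'm, 'k, 'b::{finite,linorder}) baecklund_data \<Rightarrow>
    ('n, 'a) pt \<Rightarrow> 'a ext set" where
  "pI1 X \<equiv> pull_bundle (AM X) (pr X) (deg1 (AM X) (IM X))"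

abbreviation pI1b :: "('n, 'a::{finite,linorder}, 'm, 'k, 'b::{finite,linorder}) baecklund_data \<Rightarrow>
    ('n, 'a) pt \<Rightarrow> 'a ext set" where
  "pI1b X \<equiv> pull_bundle (AMb X) (prb X) (deg1 (AMb X) (IMb X))"

abbreviation B1 :: "('n, 'a::{finite,linorder}, 'm, 'k, 'b::finite) baecklund_data \<Rightarrow>
    ('n, 'a) pt \<Rightarrow> 'a ext set" where
  "B1 X \<equiv> deg1 (AN X) (BN X)"

definition type_A :: "('n::{t2_space,second_countable_topology}, 7,
    'm::{t2_space,second_countable_topology}, 'k::{t2_space,second_countable_topology}, 5)
    baecklund_data \<Rightarrow> bool" where
  "type_A X \<longleftrightarrow> baecklund 2 X \<and> hyperbolic_MA (AM X) (IM X) \<and> hyperbolic_MA (AMb X) (IMb X) \<and>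
     (\<forall>z\<in>pts (AN X) UNIV. pI1 X z \<inter> pI1b X z = {0} \<and> dim (B1 X z) = 3) \<and>
     (\<forall>W \<theta> \<theta>b \<gamma>. open W \<and> {\<theta>, \<theta>b, \<gamma>} \<subseteq> kforms (AN X) W 1 \<and>
        (\<forall>z\<in>pts (AN X) W. span {\<theta> z} = pI1 X z \<and> span {\<theta>b z} = pI1b X z \<and>
           span {\<theta> z, \<theta>b z, \<gamma> z} = B1 X z) \<longrightarrow>
        (\<forall>z\<in>pts (AN X) W. \<forall>l m. cong_mod {\<theta> z, \<theta>b z, \<gamma> z} (l *\<^sub>R ext_d \<theta> z + m *\<^sub>R ext_d \<theta>b z) 0 \<longleftrightarrow>
           l = 0 \<and> m = 0))"

text \<open>The characteristic systems, with a chosen order.\<close>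

definition characteristic_systems :: "('n, 7, 'm, 'k, 5) baecklund_data \<Rightarrow>
    (('n::topological_space, 7) pt \<Rightarrow> 7 ext set) \<Rightarrow> (('n, 7) pt \<Rightarrow> 7 ext set) \<Rightarrow> bool" where
  "characteristic_systems X \<chi>10 \<chi>01 \<longleftrightarrow>
     (\<forall>p. \<exists>W \<omega>1 \<omega>2 \<omega>3 \<omega>4. open W \<and> p \<in> W \<and> {\<omega>1, \<omega>2, \<omega>3, \<omega>4} \<subseteq> kforms (AN X) W 1 \<and>
        (\<forall>z\<in>pts (AN X) W. dim (B1 X z \<union> {\<omega>1 z, \<omega>2 z, \<omega>3 z, \<omega>4 z}) = 7) \<and>
        alg_ideal (AN X) W (BN X) = alg_ideal (AN X) W
          (sections (AN X) W (B1 X) \<union> {\<lambda>z. \<omega>1 z \<and>\<^sub>w \<omega>2 z, \<lambda>z. \<omega>3 z \<and>\<^sub>w \<omega>4 z}) \<and>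
        (\<forall>z\<in>pts (AN X) W. \<chi>10 z = span (B1 X z \<union> {\<omega>1 z, \<omega>2 z}) \<and>
           \<chi>01 z = span (B1 X z \<union> {\<omega>3 z, \<omega>4 z})))"

text \<open>
  A coframing \<open>(\<omega>\<^sup>0, \<omega>b\<^sup>0, \<gamma>, \<omega>\<^sup>1, \<dots>, \<omega>\<^sup>4)\<close> is given by \<open>\<omega> 0\<close>, \<open>\<omega>b\<close>, \<open>\<gamma>\<close>, \<open>\<omega> 1\<close>, \dots, \<open>\<omega> 4\<close>. The coefficient
  functions are \<open>A\<close>, \<open>C 0\<close>, \dots, \<open>C 4\<close>, \<open>D 1\<close>, \dots, \<open>D 4\<close>.
\<close>

definition one_adapted :: "('n, 7, 'm, 'k, 5) baecklund_data \<Rightarrow>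
    (('n, 7) pt \<Rightarrow> 7 ext set) \<Rightarrow> (('n, 7) pt \<Rightarrow> 7 ext set) \<Rightarrow> real \<Rightarrow> 'n set \<Rightarrow>
    (nat \<Rightarrow> ('n, 7) form) \<Rightarrow> ('n, 7) form \<Rightarrow> ('n, 7) form \<Rightarrow>
    ('n \<Rightarrow> real) \<Rightarrow> (nat \<Rightarrow> 'n \<Rightarrow> real) \<Rightarrow> (nat \<Rightarrow> 'n \<Rightarrow> real) \<Rightarrow> bool" where
  "one_adapted X \<chi>10 \<chi>01 \<epsilon> W \<omega> \<omega>b \<gamma> A C D \<longleftrightarrow>
     (\<forall>i\<le>4. \<omega> i \<in> kforms (AN X) W 1) \<and> \<omega>b \<in> kforms (AN X) W 1 \<and> \<gamma> \<in> kforms (AN X) W 1 \<and>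
     \<epsilon> \<in> {1, -1} \<and> (\<forall>p\<in>W. A p > 0 \<and> (A p)\<^sup>2 \<noteq> \<epsilon>) \<and>
     (\<forall>z\<in>pts (AN X) W. let p = base z in
        dim {\<omega> 0 z, \<omega>b z, \<gamma> z, \<omega> 1 z, \<omega> 2 z, \<omega> 3 z, \<omega> 4 z} = 7 \<and>
        span {\<omega> 0 z} = pI1 X z \<and> span {\<omega>b z} = pI1b X z \<and> span {\<omega> 0 z, \<omega>b z, \<gamma> z} = B1 X z \<and>
        span {\<omega> 0 z, \<omega>b z, \<gamma> z, \<omega> 1 z, \<omega> 2 z} = \<chi>10 z \<and>
        span {\<omega> 0 z, \<omega>b z, \<gamma> z, \<omega> 3 z, \<omega> 4 z} = \<chi>01 z \<and>
        cong_mod {\<omega> 0 z} (ext_d (\<omega> 0) z)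
          (A p *\<^sub>R \<omega> 1 z \<and>\<^sub>w \<omega> 2 z + \<omega> 3 z \<and>\<^sub>w (\<omega> 4 z + \<gamma> z)) \<and>
        cong_mod {\<omega>b z} (ext_d \<omega>b z)
          (\<omega> 1 z \<and>\<^sub>w (\<omega> 2 z + \<gamma> z) + (\<epsilon> * A p) *\<^sub>R \<omega> 3 z \<and>\<^sub>w \<omega> 4 z) \<and>
        cong_mod {\<gamma> z} (ext_d \<gamma> z)
          (C 0 p *\<^sub>R \<omega> 0 z \<and>\<^sub>w \<omega>b z + (\<Sum>i=1..4. C i p *\<^sub>R \<omega> i z \<and>\<^sub>w \<omega> 0 z)
             + (\<Sum>i=1..4. D i p *\<^sub>R \<omega> i z \<and>\<^sub>w \<omega>b z)))"

definition type_A1 :: "('n::{t2_space,second_countable_topology}, 7,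
    'm::{t2_space,second_countable_topology}, 'k::{t2_space,second_countable_topology}, 5)
    baecklund_data \<Rightarrow> (('n, 7) pt \<Rightarrow> 7 ext set) \<Rightarrow> (('n, 7) pt \<Rightarrow> 7 ext set) \<Rightarrow> real \<Rightarrow> bool" where
  "type_A1 X \<chi>10 \<chi>01 \<epsilon> \<longleftrightarrow> type_A X \<and> characteristic_systems X \<chi>10 \<chi>01 \<and>
     (\<forall>p. \<exists>W \<omega> \<omega>b \<gamma> A C D. open W \<and> p \<in> W \<and> one_adapted X \<chi>10 \<chi>01 \<epsilon> W \<omega> \<omega>b \<gamma> A C D)"

text \<open>
  The structure equations of the \<open>G\<^sub>1\<close>-structure of 1-adapted coframings, pulled back to \<open>W\<close> by the
  section \<open>(\<omega>, \<omega>b, \<gamma>)\<close>. They determine the functions \<open>A\<close>, \<open>C\<close>, \<open>D\<close>, \<open>K\<close>, \<open>P\<close>, \<open>S\<close> on \<open>W\<close>, although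
  they do not determine \<open>\<alpha>\<close>, \<open>\<phi>\<close>, \<open>\<beta>1\<close>, \<open>\<beta>2\<close>.
\<close>

definition G1_structure_equations :: "('n, 7, 'm, 'k, 5) baecklund_data \<Rightarrow> real \<Rightarrow> 'n set \<Rightarrow>
    (nat \<Rightarrow> ('n, 7) form) \<Rightarrow> ('n, 7) form \<Rightarrow> ('n, 7) form \<Rightarrow>
    ('n \<Rightarrow> real) \<Rightarrow> (nat \<Rightarrow> 'n \<Rightarrow> real) \<Rightarrow> (nat \<Rightarrow> 'n \<Rightarrow> real) \<Rightarrow>
    ('n \<Rightarrow> real) \<Rightarrow> (nat \<Rightarrow> 'n \<Rightarrow> real) \<Rightarrow> (nat \<Rightarrow> 'n \<Rightarrow> real) \<Rightarrow> bool" where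
  "G1_structure_equations X \<epsilon> W \<omega> \<omega>b \<gamma> A C D K P S \<longleftrightarrow>
     (\<exists>\<alpha> \<phi> \<beta>1 \<beta>2 \<Omega>1 \<Omega>2 \<Omega>3 \<Omega>4.
        {\<alpha>, \<phi>, \<beta>1, \<beta>2} \<subseteq> kforms (AN X) W 1 \<and> {\<Omega>1, \<Omega>2, \<Omega>3, \<Omega>4} \<subseteq> kforms (AN X) W 2 \<and>
        (\<forall>z\<in>pts (AN X) W. let p = base z;
            \<kappa> = K p *\<^sub>R \<gamma> z + (\<Sum>i=1..4. P i p *\<^sub>R \<omega> i z);
            \<Omega>0 = A p *\<^sub>R \<omega> 1 z \<and>\<^sub>w \<omega> 2 z + \<omega> 3 z \<and>\<^sub>w (\<omega> 4 z + \<gamma> z) + \<kappa> \<and>\<^sub>w \<omega> 0 z;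
            \<Omega>b = \<omega> 1 z \<and>\<^sub>w (\<omega> 2 z + \<gamma> z) + (\<epsilon> * A p) *\<^sub>R \<omega> 3 z \<and>\<^sub>w \<omega> 4 z - \<kappa> \<and>\<^sub>w \<omega>b z;
            \<Gamma> = C 0 p *\<^sub>R \<omega> 0 z \<and>\<^sub>w \<omega>b z + (\<Sum>i=1..4. C i p *\<^sub>R \<omega> i z \<and>\<^sub>w \<omega> 0 z)
                 + (\<Sum>i=1..4. D i p *\<^sub>R \<omega> i z \<and>\<^sub>w \<omega>b z)
          in
            ext_d (\<omega> 0) z = - ((\<alpha> z + \<phi> z) \<and>\<^sub>w \<omega> 0 z) + \<Omega>0 \<and>
            ext_d \<omega>b z = - ((\<alpha> z + \<phi> z) \<and>\<^sub>w \<omega>b z) + \<Omega>b \<and>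
            ext_d \<gamma> z = - (\<phi> z \<and>\<^sub>w \<gamma> z) + \<Gamma> \<and>
            ext_d (\<omega> 1) z = - (\<alpha> z \<and>\<^sub>w \<omega> 1 z) + \<Omega>1 z \<and>
            ext_d (\<omega> 2) z = - (\<beta>1 z \<and>\<^sub>w \<omega> 1 z) - \<phi> z \<and>\<^sub>w \<omega> 2 z + \<Omega>2 z \<and>
            ext_d (\<omega> 3) z = - (\<alpha> z \<and>\<^sub>w \<omega> 3 z) + \<Omega>3 z \<and>
            ext_d (\<omega> 4) z = - (\<beta>2 z \<and>\<^sub>w \<omega> 3 z) - \<phi> z \<and>\<^sub>w \<omega> 4 z + \<Omega>4 z \<and>
            cong_mod {\<omega> 0 z, \<omega> 1 z, \<omega> 2 z} (\<Omega>1 z) (S 1 p *\<^sub>R \<omega> 3 z \<and>\<^sub>w (\<omega> 4 z + \<gamma> z)) \<and>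
            cong_mod {\<omega> 0 z, \<omega> 1 z, \<omega> 2 z} (\<Omega>2 z) (S 2 p *\<^sub>R \<omega> 3 z \<and>\<^sub>w (\<omega> 4 z + \<gamma> z)) \<and>
            cong_mod {\<omega>b z, \<omega> 3 z, \<omega> 4 z} (\<Omega>3 z) (S 3 p *\<^sub>R \<omega> 1 z \<and>\<^sub>w (\<omega> 2 z + \<gamma> z)) \<and>
            cong_mod {\<omega>b z, \<omega> 3 z, \<omega> 4 z} (\<Omega>4 z) (S 4 p *\<^sub>R \<omega> 1 z \<and>\<^sub>w (\<omega> 2 z + \<gamma> z))))"

text \<open>\<open>M0\<close> and \<open>Mb0\<close> are the coefficients of \<open>\<gamma> \<and> \<omega>\<^sup>0\<close> and \<open>\<gamma> \<and> \<omega>b\<^sup>0\<close> in the expansion of \<open>d\<gamma>\<close>.\<close>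

definition gamma_coefficients :: "('n, 7, 'm, 'k, 5) baecklund_data \<Rightarrow>
    (nat \<Rightarrow> ('n, 7) form) \<Rightarrow> ('n, 7) form \<Rightarrow> ('n, 7) form \<Rightarrow>
    ('n \<Rightarrow> real) \<Rightarrow> ('n \<Rightarrow> real) \<Rightarrow> bool" where
  "gamma_coefficients X \<omega> \<omega>b \<gamma> M0 Mb0 \<longleftrightarrow> (\<forall>z\<in>pts (AN X) UNIV.
     ext_d \<gamma> z - M0 (base z) *\<^sub>R \<gamma> z \<and>\<^sub>w \<omega> 0 z - Mb0 (base z) *\<^sub>R \<gamma> z \<and>\<^sub>w \<omega>b z
       \<in> span ({\<omega> 0 z \<and>\<^sub>w \<omega>b z} \<union> {\<omega> i z \<and>\<^sub>w \<eta> | i \<eta>. i \<in> {1..4} \<and>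
                 \<eta> \<in> {\<omega> 0 z, \<omega>b z, \<gamma> z, \<omega> 1 z, \<omega> 2 z, \<omega> 3 z, \<omega> 4 z}}))"


section \<open>The canonical structure equations\<close>

definition structure_equations_S1 :: "('n, 7, 'm, 'k, 5) baecklund_data \<Rightarrow> real \<Rightarrow>
    (nat \<Rightarrow> ('n, 7) form) \<Rightarrow> ('n, 7) form \<Rightarrow> ('n, 7) form \<Rightarrow> (nat \<Rightarrow> 'n \<Rightarrow> real) \<Rightarrow> bool" where
  "structure_equations_S1 X \<epsilon> \<omega> \<omega>b \<gamma> H \<longleftrightarrow> (\<forall>z\<in>pts (AN X) UNIV.
    let H1 = H 1 (base z); H2 = H 2 (base z); H3 = H 3 (base z); H4 = H 4 (base z);
        w0 = \<omega> 0 z; wb = \<omega>b z; g = \<gamma> z; w1 = \<omega> 1 z; w2 = \<omega> 2 z; w3 = \<omega> 3 z; w4 = \<omega> 4 z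
    in
      ext_d (\<omega> 0) z =
        (1/2 * (1 - \<epsilon> * H2 / H1\<^sup>2)) *\<^sub>R w0 \<and>\<^sub>w wb
        + (3 * \<epsilon> * H4 - H3 + 1) *\<^sub>R w0 \<and>\<^sub>w g
        + H1 *\<^sub>R w1 \<and>\<^sub>w w2
        - (1/2 * (H2 * (\<epsilon> * H4 - 3 * H3 - 3) - 3 * \<epsilon> * H4 + H3 - 3)) *\<^sub>R w0 \<and>\<^sub>w w2
        + w3 \<and>\<^sub>w (w4 + g)
        - (1/2 * (H3 - 3 * \<epsilon> * H4 + 1 + H1\<^sup>2 * (\<epsilon> * H3 - 3 * H4 - 3 * \<epsilon>) / H2)) *\<^sub>R w0 \<and>\<^sub>w w4
    \<and> ext_d \<omega>b z =
        (3 * \<epsilon> * H4 - H3 + 3) *\<^sub>R wb \<and>\<^sub>w (w2 + g)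
        + (\<epsilon> * H4 + H3 + 1) *\<^sub>R wb \<and>\<^sub>w w4
        + w1 \<and>\<^sub>w (w2 + g)
        + (\<epsilon> * H1) *\<^sub>R w3 \<and>\<^sub>w w4
    \<and> ext_d \<gamma> z =
        (1 / H1) *\<^sub>R (H3 *\<^sub>R g + H2 *\<^sub>R w2 - w4) \<and>\<^sub>w w0
        + ((H2 * H4 / H1\<^sup>2) *\<^sub>R g - (\<epsilon> * H2 / H1\<^sup>2) *\<^sub>R w2 + w4) \<and>\<^sub>w wb
        + (3/4 + \<epsilon> * H2 / (4 * H1\<^sup>2)) *\<^sub>R w1 \<and>\<^sub>w g
        + ((3 * \<epsilon> * H4 - H3 + 3) * (\<epsilon> * H4 + 1)) *\<^sub>R w2 \<and>\<^sub>w g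
        - ((3 * H2 + 1) / (4 * H1)) *\<^sub>R w3 \<and>\<^sub>w g
        + ((\<epsilon> * H4 - 3 * H3 - 3) * (H3 + 1)) *\<^sub>R w4 \<and>\<^sub>w g
    \<and> ext_d (\<omega> 1) z =
        (3 * H4\<^sup>2 - 3 * H3\<^sup>2 + 8 * \<epsilon> * H4 - 6 * H3 + 1) *\<^sub>R w1 \<and>\<^sub>w g
        + ((H3 + 1) / H1) *\<^sub>R w0 \<and>\<^sub>w w1
        + (3 * H4\<^sup>2 - \<epsilon> * H3 * H4 + 7 * \<epsilon> * H4 + 4) *\<^sub>R w1 \<and>\<^sub>w w2
        + (H2 * (H4 + \<epsilon>) / H1\<^sup>2) *\<^sub>R wb \<and>\<^sub>w w1
        - (3 * H3\<^sup>2 - \<epsilon> * H3 * H4 + 5 * H3 - 2 * \<epsilon> * H4 + 2) *\<^sub>R w1 \<and>\<^sub>w w4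
        - ((3 * H2 + 1) / (4 * H1)) *\<^sub>R w1 \<and>\<^sub>w w3
    \<and> ext_d (\<omega> 2) z =
        - ((1 / H1) *\<^sub>R w0 \<and>\<^sub>w (w4 + g))
        + ((H2 - H3 - 1) / H1) *\<^sub>R w0 \<and>\<^sub>w w2
        - (H2 * (H4 + \<epsilon>) / H1\<^sup>2) *\<^sub>R wb \<and>\<^sub>w w2
        + (3/4 + \<epsilon> * H2 / (4 * H1\<^sup>2)) *\<^sub>R w1 \<and>\<^sub>w w2
        + (3 * H3\<^sup>2 - 3 * H4\<^sup>2 + 7 * H3 - 7 * \<epsilon> * H4) *\<^sub>R w2 \<and>\<^sub>w g
        + ((3 * H2 + 1) / (4 * H1)) *\<^sub>R w2 \<and>\<^sub>w w3
        - ((\<epsilon> * H4 - 3 * H3 - 3) * (H3 + 1)) *\<^sub>R w2 \<and>\<^sub>w w4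
    \<and> ext_d (\<omega> 3) z =
        ((1 + H2 + 2 * H3) / (2 * H1)) *\<^sub>R w0 \<and>\<^sub>w w3
        + (- 1/2 + H2 * H4 / H1\<^sup>2 + 3 * \<epsilon> * H2 / (2 * H1\<^sup>2)) *\<^sub>R wb \<and>\<^sub>w w3
        - (3/4 + \<epsilon> * H2 / (4 * H1\<^sup>2)) *\<^sub>R w1 \<and>\<^sub>w w3
        + (3 * H4\<^sup>2 + 8 * \<epsilon> * H4 - 3 * H3\<^sup>2 - 6 * H3 + 3) *\<^sub>R w3 \<and>\<^sub>w g
        + (1/2 * (\<epsilon> * H4 * (H2 + 2 * H3 - 6 * \<epsilon> * H4 - 15) - 3 * H2 * H3 - 3 * H2 + 3 * H3 - 9))
            *\<^sub>R w2 \<and>\<^sub>w w3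
        - (1/2 * (H1\<^sup>2 * (\<epsilon> * H3 - 3 * H4 - 3 * \<epsilon>) / H2 + (3 * H3 - \<epsilon> * H4 + 3) * (2 * H3 + 1)))
            *\<^sub>R w3 \<and>\<^sub>w w4
    \<and> ext_d (\<omega> 4) z =
        - (((H3 + 1) / H1) *\<^sub>R w0 \<and>\<^sub>w w4)
        - (\<epsilon> * H2 / H1\<^sup>2) *\<^sub>R wb \<and>\<^sub>w (w2 + g)
        + (1 - H2 * (H4 + \<epsilon>) / H1\<^sup>2) *\<^sub>R wb \<and>\<^sub>w w4
        + (3/4 + \<epsilon> * H2 / (4 * H1\<^sup>2)) *\<^sub>R w1 \<and>\<^sub>w w4
        + ((H4 + \<epsilon>) * (3 * H4 - \<epsilon> * H3 + 3 * \<epsilon>)) *\<^sub>R w2 \<and>\<^sub>w w4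
        - ((3 * H2 + 1) / (4 * H1)) *\<^sub>R w3 \<and>\<^sub>w w4
        + (3 * H3\<^sup>2 - 3 * H4\<^sup>2 + 7 * H3 - 7 * \<epsilon> * H4) *\<^sub>R w4 \<and>\<^sub>w g)"

definition structure_equations_S2 :: "('n, 7, 'm, 'k, 5) baecklund_data \<Rightarrow> real \<Rightarrow>
    (nat \<Rightarrow> ('n, 7) form) \<Rightarrow> ('n, 7) form \<Rightarrow> ('n, 7) form \<Rightarrow> (nat \<Rightarrow> 'n \<Rightarrow> real) \<Rightarrow> bool" where
  "structure_equations_S2 X \<epsilon> \<omega> \<omega>b \<gamma> H \<longleftrightarrow> (\<forall>z\<in>pts (AN X) UNIV.
    let H1 = H 1 (base z); H2 = H 2 (base z); H3 = H 3 (base z); H4 = H 4 (base z);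
        w0 = \<omega> 0 z; wb = \<omega>b z; g = \<gamma> z; w1 = \<omega> 1 z; w2 = \<omega> 2 z; w3 = \<omega> 3 z; w4 = \<omega> 4 z
    in
      ext_d (fun_form (H 1)) z =
        - ((1/2 * (H2 - 1)) *\<^sub>R w0)
        - (1/2 * (H1 - \<epsilon> * H2 / H1)) *\<^sub>R wb
        + (2 * H1 * (H3 - \<epsilon> * H4)) *\<^sub>R g
        - (H1 / 2 * (\<epsilon> * H2 * H4 + 3 * \<epsilon> * H4 - 3 * H2 * H3 - 3 * H2 - H3 + 3)) *\<^sub>R w2
        - (H1 / 2 * (H1\<^sup>2 / H2 * (3 * H4 + 3 * \<epsilon> - \<epsilon> * H3) + (\<epsilon> * H4 - 3 * H3 - 3))) *\<^sub>R w4
    \<and> ext_d (fun_form (H 2)) z =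
        (H2 * (1 - H2) / H1) *\<^sub>R w0
        + (4 * H2 * (H3 + 1)) *\<^sub>R (w4 + g)
        - (H2 * (\<epsilon> * H2 * H4 - \<epsilon> * H4 - 3 * H2 * H3 - 3 * H2 - H3 - 1)) *\<^sub>R w2
    \<and> ext_d (fun_form (H 3)) z =
        (H3 * (H3 + 1) / H1) *\<^sub>R w0
        + (H2 * (H3 + 1) * (H4 + \<epsilon>) / H1\<^sup>2) *\<^sub>R wb
        - ((6 * \<epsilon> * H4 - 3 * H3\<^sup>2 + 3 * H4\<^sup>2 - 4 * H3 + 3) * (H3 + 1)) *\<^sub>R g
        - ((H3 + 1) * (3/4 + \<epsilon> * H2 / (4 * H1\<^sup>2))) *\<^sub>R w1
        + ((3 * H2 * H3 + 4 * H2 + H3) / (4 * H1)) *\<^sub>R w3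
        - ((H3 + 1) * (3 * H4 - \<epsilon> * H3 + 3 * \<epsilon>) * (H4 + \<epsilon>)) *\<^sub>R w2
        - (H3 * (H3 + 1) * (\<epsilon> * H4 - 3 * H3 - 3)) *\<^sub>R w4
    \<and> ext_d (fun_form (H 4)) z =
        ((H3 + 1) * (H4 + \<epsilon>) / H1) *\<^sub>R w0
        + (H2 * H4 * (H4 + \<epsilon>) / H1\<^sup>2) *\<^sub>R wb
        - ((4 * \<epsilon> * H4 - 3 * H3\<^sup>2 + 3 * H4\<^sup>2 - 6 * H3 - 3) * (H4 + \<epsilon>)) *\<^sub>R g
        - (3 * H4 / 4 + \<epsilon> * H2 * H4 / (4 * H1\<^sup>2) + \<epsilon>) *\<^sub>R w1
        - (H4 * (3 * \<epsilon> * H4 - H3 + 3) * (\<epsilon> * H4 + 1)) *\<^sub>R w2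
        + ((H4 + \<epsilon>) * (3 * H2 + 1) / (4 * H1)) *\<^sub>R w3
        - ((H3 + 1) * (H4 + \<epsilon>) * (\<epsilon> * H4 - 3 * H3 - 3)) *\<^sub>R w4)"

text \<open>
  The cohomogeneity is the codimension of the orbits of the local symmetries. A local symmetry preserves
  the canonical coframing, and all invariants of this \<open>{e}\<close>-structure are functions of
  \<open>(H\<^sub>1, \<dots>, H\<^sub>4)\<close>, so this codimension is the rank of the map \<open>(H\<^sub>1, \<dots>, H\<^sub>4)\<close>, required here at every point.
\<close>

definition of_cohomogeneity :: "('n, 7, 'm, 'k, 5) baecklund_data \<Rightarrow> (nat \<Rightarrow> 'n \<Rightarrow> real) \<Rightarrow> nat \<Rightarrow>
    bool" where
  "of_cohomogeneity X H k \<longleftrightarrow>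
     (\<forall>z\<in>pts (AN X) UNIV. map_rank (\<lambda>p. (H 1 p, H 2 p, H 3 p, H 4 p)) z = k)"

end

theory Submission
  imports Defs
begin

text \<open>
  By the structure equations (S2), each \<open>dH\<^sub>i\<close> is a combination of the seven 1-forms of the canonical
  coframing with coefficients that are rational functions of \<open>h = (H\<^sub>1, \<dots>, H\<^sub>4)\<close>. The coframing is
  pointwise independent, so the rank of the map \<open>(H\<^sub>1, \<dots>, H\<^sub>4)\<close> at a point is the rank of a \<open>4 \<times> 7\<close>
  matrix \<open>J(h)\<close>, that is, 4 minus the dimension of its left kernel (\<open>map_rank_invs\<close>). The cohomogeneity
  therefore comes down to two questions: how this dimension depends on \<open>h\<close>, and why it is the same at
  all points of the connected manifold \<open>N\<close>.

  For the first question, write \<open>a = H\<^sub>3 + 1\<close>, \<open>b = \<epsilon> H\<^sub>4 + 1\<close>, \<open>s = H\<^sub>2 - 1\<close>, \<open>m = 3 H\<^sub>2 + 1\<close>,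
  \<open>q = H\<^sub>1\<^sup>2 - \<epsilon> H\<^sub>2\<close>, \<open>n = 3 H\<^sub>1\<^sup>2 + \<epsilon> H\<^sub>2\<close>. Only \<open>dH\<^sub>3\<close> and \<open>dH\<^sub>4\<close> involve \<open>\<omega>\<^sup>1\<close> and \<open>\<omega>\<^sup>3\<close>, and the
  corresponding \<open>2 \<times> 2\<close> minor is, up to a nonzero factor, \<open>\<Delta> = \<epsilon> (a m q + s (q + n b))\<close>, which is the
  difference of the two sides of the equation that characterizes cohomogeneity 3. The rows of \<open>dH\<^sub>1\<close>
  and \<open>dH\<^sub>2\<close> are independent unless \<open>s = a = 0\<close> (the first locus) or \<open>q = b = 0\<close> (the second locus), and \<open>\<Delta>\<close> vanishes on both loci.
  Hence the rank is 4 where \<open>\<Delta> \<noteq> 0\<close>. The decisive identity is \<open>d\<Delta> = \<Delta> \<lambda>\<close> for an explicit 1-form \<open>\<lambda>\<close>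
  (\<open>Delta_differential\<close>): where \<open>\<Delta> = 0\<close>, the gradient of \<open>\<Delta>\<close> with respect to \<open>h\<close> lies in the left kernel,
  and it is not zero there. Off the two loci it spans the kernel, so the rank is 3; on each locus
  the kernel is computed directly and has dimension 2 (\<open>dim_left_kernel\<close>).

  For the second question, the pairs of functions that define the two loci satisfy linear equations of
  the same kind as \<open>\<Delta>\<close>: their differentials are combinations of the functions themselves, with 1-forms
  as coefficients. A Gronwall estimate along segments shows that the common zero set of such a system is
  open; being closed too, it is empty or all of \<open>N\<close>
  (\<open>common_zeros_everywhere_or_nowhere\<close>). So each of the three conditions holds everywhere or nowhere,
  and the pointwise rank is constant on \<open>N\<close>.
\<close>

section \<open>Propagation of common zeros along a linear differential system\<close>

text \<open>
  Gronwall's argument: along the segment from the centre to \<open>y\<close>, the sum of the squares of the \<open>f i\<close> is a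
  nonnegative function \<open>g\<close> with \<open>g' \<le> K g\<close> that starts at 0, so \<open>g t * exp (- K t)\<close> cannot increase and \<open>g\<close>
  stays 0.
\<close>

lemma common_zeros_on_ball:
  fixes f :: "'j \<Rightarrow> 'a::euclidean_space \<Rightarrow> real" and L :: "'j \<Rightarrow> 'j \<Rightarrow> 'a \<Rightarrow> 'a"
  assumes J: "finite J"
    and der: "\<And>i x. i \<in> J \<Longrightarrow> x \<in> ball x0 r \<Longrightarrow>
      (f i has_derivative (\<lambda>v. \<Sum>j\<in>J. f j x * (L i j x \<bullet> v))) (at x)"
    and bound: "\<And>i j x. i \<in> J \<Longrightarrow> j \<in> J \<Longrightarrow> x \<in> ball x0 r \<Longrightarrow> norm (L i j x) \<le> B"
    and zero: "\<And>i. i \<in> J \<Longrightarrow> f i x0 = 0"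
    and y: "y \<in> ball x0 r" and k: "k \<in> J"
  shows "f k y = 0"
proof -
  define w where "w = y - x0"
  define l where "l t = x0 + t *\<^sub>R w" for t :: real
  define g where "g t = (\<Sum>i\<in>J. (f i (l t))\<^sup>2)" for t
  define g' where "g' t = (\<Sum>i\<in>J. 2 * f i (l t) * (\<Sum>j\<in>J. f j (l t) * (L i j (l t) \<bullet> w)))" for t
  define K where "K = 2 * real (card J) * (B * norm w)"
  have nw: "norm w < r"
    using y by (simp add: w_def dist_norm norm_minus_commute)
  have l_ball: "l t \<in> ball x0 r" if "0 \<le> t" "t \<le> 1" for t
  proof -
    have "norm (t *\<^sub>R w) \<le> norm w"
      using that by (simp add: mult_left_le_one_le)
    then show ?thesis
      using nw by (simp add: l_def dist_norm)
  qed
  have g_der: "(g has_real_derivative g' t) (at t)" if t: "0 \<le> t" "t \<le> 1" for t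
  proof -
    have l_der: "(l has_derivative (\<lambda>s. s *\<^sub>R w)) (at t)"
      unfolding l_def by (auto intro!: derivative_eq_intros)
    have "((\<lambda>t. f i (l t)) has_derivative (\<lambda>s. \<Sum>j\<in>J. f j (l t) * (L i j (l t) \<bullet> (s *\<^sub>R w)))) (at t)"
      if "i \<in> J" for i
      using has_derivative_compose[OF l_der der[OF that l_ball[OF t]]] .
    then have "((\<lambda>t. f i (l t)) has_real_derivative (\<Sum>j\<in>J. f j (l t) * (L i j (l t) \<bullet> w))) (at t)"
      if "i \<in> J" for i
      using that by (auto simp: sum_distrib_left mult_ac intro!: has_derivative_imp_has_field_derivative)
    then show ?thesis
      unfolding g_def g'_def by (auto intro!: derivative_eq_intros sum.cong)
  qed
  have g'_le: "g' t \<le> K * g t" if t: "0 \<le> t" "t \<le> 1" for t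
  proof -
    have "2 * f i (l t) * (f j (l t) * (L i j (l t) \<bullet> w))
        \<le> ((f i (l t))\<^sup>2 + (f j (l t))\<^sup>2) * (B * norm w)" if "i \<in> J" "j \<in> J" for i j
    proof -
      have "\<bar>L i j (l t) \<bullet> w\<bar> \<le> norm (L i j (l t)) * norm w"
        by (rule Cauchy_Schwarz_ineq2)
      also have "\<dots> \<le> B * norm w"
        using bound[OF that l_ball[OF t]] by (intro mult_right_mono) auto
      finally have L: "\<bar>L i j (l t) \<bullet> w\<bar> \<le> B * norm w" .
      have P: "\<bar>2 * f i (l t) * f j (l t)\<bar> \<le> (f i (l t))\<^sup>2 + (f j (l t))\<^sup>2"
        using sum_squares_bound[of "\<bar>f i (l t)\<bar>" "\<bar>f j (l t)\<bar>"] by (simp add: abs_mult)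
      have "2 * f i (l t) * (f j (l t) * (L i j (l t) \<bullet> w))
          \<le> \<bar>2 * f i (l t) * f j (l t)\<bar> * \<bar>L i j (l t) \<bullet> w\<bar>"
        by (metis abs_ge_self abs_mult mult.assoc)
      also have "\<dots> \<le> ((f i (l t))\<^sup>2 + (f j (l t))\<^sup>2) * (B * norm w)"
        by (intro mult_mono P L) auto
      finally show ?thesis .
    qed
    then have "g' t \<le> (\<Sum>i\<in>J. \<Sum>j\<in>J. ((f i (l t))\<^sup>2 + (f j (l t))\<^sup>2) * (B * norm w))"
      unfolding g'_def by (auto simp: sum_distrib_left intro!: sum_mono)
    also have "\<dots> = K * g t"
      by (simp add: g_def K_def sum.distrib distrib_right flip: sum_distrib_right sum_distrib_left)
    finally show ?thesis .
  qed
  have "g 1 * exp (- K * 1) \<le> g 0 * exp (- K * 0)"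
  proof (rule DERIV_nonpos_imp_nonincreasing[where f = "\<lambda>t. g t * exp (- K * t)"])
    fix t :: real
    assume t: "0 \<le> t" "t \<le> 1"
    have "((\<lambda>t. g t * exp (- K * t)) has_real_derivative (g' t - K * g t) * exp (- K * t)) (at t)"
      using g_der[OF t] by (auto intro!: derivative_eq_intros simp: algebra_simps)
    then show "\<exists>y. ((\<lambda>t. g t * exp (- K * t)) has_real_derivative y) (at t) \<and> y \<le> 0"
      using g'_le[OF t] by (auto simp: mult_nonpos_nonneg)
  qed auto
  moreover have "g 0 = 0"
    using zero by (simp add: g_def l_def)
  ultimately have "g 1 \<le> 0"
    by (simp add: mult_le_0_iff)
  then have "g 1 = 0"
    by (intro antisym) (auto simp: g_def sum_nonneg)
  then have "(f k (l 1))\<^sup>2 = 0"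
    using J k by (simp add: g_def sum_nonneg_eq_0_iff)
  then show ?thesis
    by (simp add: l_def w_def)
qed

lemma smooth_on_imp_continuous_on: "smooth_on S f \<Longrightarrow> continuous_on S f"
  unfolding smooth_on_def by (metis Ck_on.simps(1))

lemma smooth_on_imp_differentiable: "smooth_on S f \<Longrightarrow> x \<in> S \<Longrightarrow> f differentiable (at x)"
  unfolding smooth_on_def by (metis Ck_on.simps(2))

lemma smooth_manifold_chart:
  assumes "smooth_manifold A" "c \<in> A"
  shows "open (fst c)" "open (snd c ` fst c)" "continuous_on (fst c) (snd c)"
    "continuous_on (snd c ` fst c) (chart_inv c)"
    "\<And>p. p \<in> fst c \<Longrightarrow> chart_inv c (snd c p) = p"
    "\<And>x. x \<in> snd c ` fst c \<Longrightarrow> chart_inv c x \<in> fst c"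
  using assms unfolding smooth_manifold_def homeomorphism_def by auto

text \<open>
  The common zero set is closed by continuity. It is open because in a chart the coefficients \<open>L\<close> are
  bounded on a compact ball, where the Gronwall argument applies.
\<close>

theorem common_zeros_everywhere_or_nowhere:
  fixes A :: "('n::{t2_space,second_countable_topology}, 'm::finite) chart set"
    and f :: "'j \<Rightarrow> 'n \<Rightarrow> real" and L :: "'j \<Rightarrow> 'j \<Rightarrow> ('n, 'm) pt \<Rightarrow> real ^ 'm"
  assumes A: "smooth_manifold A" and conn: "connected (UNIV :: 'n set)" and J: "finite J"
    and der: "\<And>i c x. i \<in> J \<Longrightarrow> c \<in> A \<Longrightarrow> x \<in> snd c ` fst c \<Longrightarrow>
      ((f i \<circ> chart_inv c) has_derivative (\<lambda>v. \<Sum>j\<in>J. f j (chart_inv c x) * (L i j (c, x) \<bullet> v))) (at x)"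
    and cont: "\<And>i j c. i \<in> J \<Longrightarrow> j \<in> J \<Longrightarrow> c \<in> A \<Longrightarrow> continuous_on (snd c ` fst c) (\<lambda>x. L i j (c, x))"
    and zero: "\<And>i. i \<in> J \<Longrightarrow> f i p = 0" and k: "k \<in> J"
  shows "f k q = 0"
proof -
  define Z where "Z = {p. \<forall>i\<in>J. f i p = 0}"
  have chart: "\<exists>c\<in>A. p \<in> fst c" for p
    using A unfolding smooth_manifold_def by blast
  have "open Z"
  proof (rule Topological_Spaces.openI)
    fix p
    assume p: "p \<in> Z"
    obtain c where c: "c \<in> A" "p \<in> fst c"
      using chart by blast
    note ch = smooth_manifold_chart[OF A c(1)]
    obtain r where r: "r > 0" "cball (snd c p) r \<subseteq> snd c ` fst c"
      using ch(2) c(2) open_contains_cball by blast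
    have "\<exists>B. \<forall>x\<in>cball (snd c p) r. norm (L i j (c, x)) \<le> B" if "i \<in> J" "j \<in> J" for i j
    proof -
      have "compact ((\<lambda>x. L i j (c, x)) ` cball (snd c p) r)"
        by (rule compact_continuous_image[OF continuous_on_subset[OF cont[OF that c(1)] r(2)]]) simp
      then show ?thesis
        using compact_imp_bounded bounded_iff by (metis imageI)
    qed
    then obtain b where b: "\<And>i j x. i \<in> J \<Longrightarrow> j \<in> J \<Longrightarrow> x \<in> cball (snd c p) r \<Longrightarrow>
        norm (L i j (c, x)) \<le> b i j"
      by metis
    define B where "B = (\<Sum>i\<in>J. \<Sum>j\<in>J. \<bar>b i j\<bar>)"
    have "b i j \<le> B" if "i \<in> J" "j \<in> J" for i j
    proof -
      have "b i j \<le> \<bar>b i j\<bar>" by simp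
      also have "\<dots> \<le> (\<Sum>j\<in>J. \<bar>b i j\<bar>)"
        using J that by (intro member_le_sum) auto
      also have "\<dots> \<le> B"
        unfolding B_def using J that
        by (intro member_le_sum[of i J "\<lambda>i. \<Sum>j\<in>J. \<bar>b i j\<bar>"]) (auto intro: sum_nonneg)
      finally show ?thesis .
    qed
    then have B: "norm (L i j (c, x)) \<le> B" if "i \<in> J" "j \<in> J" "x \<in> ball (snd c p) r" for i j x
      using b[OF that(1,2), of x] that by (fastforce simp: less_imp_le)
    have zeros: "(f i \<circ> chart_inv c) y = 0" if "i \<in> J" "y \<in> ball (snd c p) r" for i y
    proof (rule common_zeros_on_ball[OF J _ B _ that(2) that(1), where f = "\<lambda>i. f i \<circ> chart_inv c"])
      show "((f i \<circ> chart_inv c) has_derivative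
          (\<lambda>v. \<Sum>j\<in>J. (f j \<circ> chart_inv c) x * (L i j (c, x) \<bullet> v))) (at x)"
        if "i \<in> J" "x \<in> ball (snd c p) r" for i x
      proof -
        have "x \<in> snd c ` fst c" using that r(2) ball_subset_cball by blast
        from der[OF that(1) c(1) this] show ?thesis by simp
      qed
      show "(f i \<circ> chart_inv c) (snd c p) = 0" if "i \<in> J" for i
        using p that ch(5)[OF c(2)] by (simp add: Z_def)
    qed auto
    show "\<exists>T. open T \<and> p \<in> T \<and> T \<subseteq> Z"
    proof (intro exI conjI)
      show "open (fst c \<inter> snd c -` ball (snd c p) r)"
        using ch(1,3) by (simp add: continuous_on_open_vimage Int_commute)
      show "p \<in> fst c \<inter> snd c -` ball (snd c p) r"
        using c r by simp
      show "fst c \<inter> snd c -` ball (snd c p) r \<subseteq> Z"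
        using zeros ch(5) by (fastforce simp: Z_def)
    qed
  qed
  moreover have "closed Z"
  proof -
    have "open (- Z)"
    proof (rule Topological_Spaces.openI)
      fix p
      assume "p \<in> - Z"
      then obtain i where i: "i \<in> J" "f i p \<noteq> 0"
        by (auto simp: Z_def)
      obtain c where c: "c \<in> A" "p \<in> fst c"
        using chart by blast
      note ch = smooth_manifold_chart[OF A c(1)]
      have "continuous_on (snd c ` fst c) (f i \<circ> chart_inv c)"
        by (intro continuous_at_imp_continuous_on ballI has_derivative_continuous[OF der[OF i(1) c(1)]])
      then have "continuous_on (fst c) ((f i \<circ> chart_inv c) \<circ> snd c)"
        by (rule continuous_on_compose[OF ch(3)])
      then have "continuous_on (fst c) (f i)"
        by (rule continuous_on_cong[THEN iffD1, rotated -1]) (auto simp: ch)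
      then have "open (fst c \<inter> f i -` (- {0}))"
        using ch(1) by (rule continuous_open_preimage) auto
      then show "\<exists>T. open T \<and> p \<in> T \<and> T \<subseteq> - Z"
        using c i by (intro exI[of _ "fst c \<inter> f i -` (- {0})"]) (auto simp: Z_def)
    qed
    then show ?thesis by (simp add: closed_def)
  qed
  moreover have "p \<in> Z"
    using zero by (simp add: Z_def)
  ultimately have "Z = UNIV"
    using conn unfolding connected_clopen
    by (metis empty_iff open_openin closed_closedin subtopology_UNIV)
  then show ?thesis
    using k by (auto simp: Z_def)
qed


section \<open>Differentials of functions in a coframe\<close>

text \<open>
  The coordinate vector of the degree 1 part. It turns the evaluation \<open>pairing \<xi> v\<close> into the inner product
  with \<open>v\<close>, so that the derivative of a function is the inner product with a vector.
\<close>

definition coords :: "'m::finite ext \<Rightarrow> real ^ 'm" where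
  "coords \<xi> = (\<chi> j. \<xi> $ {j})"

lemma linear_coords: "linear coords"
  by (auto intro!: linearI simp: coords_def vec_eq_iff)

lemma coords_eq_0_imp_eq_0:
  assumes "homogeneous 1 \<xi>" "coords \<xi> = 0"
  shows "\<xi> = 0"
proof -
  have "\<xi> $ S = 0" for S
  proof (cases "card S = 1")
    case True
    then obtain j where "S = {j}" by (auto simp: card_1_singleton_iff)
    then show ?thesis using assms(2) by (simp add: coords_def vec_eq_iff)
  qed (use assms(1) in \<open>simp add: homogeneous_def\<close>)
  then show ?thesis by (simp add: vec_eq_iff)
qed

lemma homogeneous_sum_scaleR:
  assumes "\<And>i. i \<in> I \<Longrightarrow> homogeneous k (\<xi> i)"
  shows "homogeneous k (\<Sum>i\<in>I. r i *\<^sub>R \<xi> i)"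
  using assms by (simp add: homogeneous_def sum_component)

lemma linear_axis_expansion:
  fixes D :: "real ^ 'm::finite \<Rightarrow> real"
  assumes "linear D"
  shows "D v = (\<chi> j. D (axis j 1)) \<bullet> v"
proof -
  have "D v = D (\<Sum>j\<in>UNIV. v $ j *\<^sub>R axis j 1)"
    by (simp add: basis_expansion flip: scalar_mult_eq_scaleR)
  also have "\<dots> = (\<Sum>j\<in>UNIV. v $ j * D (axis j 1))"
    by (simp add: linear_sum[OF assms] linear_cmul[OF assms])
  finally show ?thesis
    by (simp add: inner_vec_def mult.commute)
qed

lemma koszul_empty: "koszul S {} = 1"
  by (simp add: koszul_def)

lemma has_derivative_ext_d_fun_form:
  fixes f :: "'p \<Rightarrow> real" and c :: "('p, 'm::{finite,linorder}) chart"
  assumes "(f \<circ> chart_inv c) differentiable (at x)"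
  shows "((f \<circ> chart_inv c) has_derivative (\<lambda>v. coords (ext_d (fun_form f) (c, x)) \<bullet> v)) (at x)"
proof -
  let ?D = "frechet_derivative (f \<circ> chart_inv c) (at x)"
  have D: "((f \<circ> chart_inv c) has_derivative ?D) (at x)"
    using assms by (simp add: frechet_derivative_works)
  have "coords (ext_d (fun_form f) (c, x)) = (\<chi> j. ?D (axis j 1))"
    by (simp add: coords_def ext_d_def koszul_empty fun_form_def base_def one_ext_def axis_def o_def)
  then have "?D = (\<lambda>v. coords (ext_d (fun_form f) (c, x)) \<bullet> v)"
    using linear_axis_expansion[OF has_derivative_linear[OF D]] by (intro ext) metis
  with D show ?thesis by simp
qed

lemma independent_list_if_dim_eq_length:
  fixes xs :: "'v::euclidean_space list"
  assumes dim: "dim (set xs) = length xs"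
    and zero: "(\<Sum>k<length xs. d k *\<^sub>R xs ! k) = 0" and k: "k < length xs"
  shows "d k = 0"
proof -
  have "dim (set xs) \<le> card (set xs)"
    by (simp add: dim_le_card')
  then have card: "card (set xs) = length xs"
    using dim card_length[of xs] by linarith
  then have "distinct xs"
    by (rule card_distinct)
  then have inj: "inj_on ((!) xs) {..<length xs}"
    by (auto simp: inj_on_def nth_eq_iff_index_eq)
  have img: "set xs = (!) xs ` {..<length xs}"
    by (auto simp: set_conv_nth)
  have ind: "independent (set xs)"
    using card dim card_eq_dim[of "set xs" "set xs"] span_superset by auto
  define u where "u v = d (the_inv_into {..<length xs} ((!) xs) v)" for v
  have u: "u (xs ! i) = d i" if "i < length xs" for i
    using that inj by (simp add: u_def the_inv_into_f_f)
  have "(\<Sum>v\<in>set xs. u v *\<^sub>R v) = (\<Sum>i<length xs. d i *\<^sub>R xs ! i)"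
    unfolding img by (subst sum.reindex[OF inj]) (auto simp: u)
  with zero have "u (xs ! k) = 0"
    using independentD[OF ind, of "set xs" u] k by simp
  then show ?thesis
    using u k by simp
qed

text \<open>
  The dimension of a coframe is measured in the whole exterior algebra; the independence carries over to
  coordinate vectors because \<open>coords\<close> is injective on 1-forms.
\<close>

lemma coords_independent:
  fixes xs :: "'m::finite ext list"
  assumes "dim (set xs) = length xs" "\<And>\<xi>. \<xi> \<in> set xs \<Longrightarrow> homogeneous 1 \<xi>"
    and "(\<Sum>k<length xs. d k *\<^sub>R coords (xs ! k)) = 0" and "k < length xs"
  shows "d k = 0"
proof (rule independent_list_if_dim_eq_length[OF assms(1) _ assms(4)])
  have "coords (\<Sum>k<length xs. d k *\<^sub>R xs ! k) = 0"
    using assms(3) by (simp add: linear_sum[OF linear_coords] linear_cmul[OF linear_coords])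
  then show "(\<Sum>k<length xs. d k *\<^sub>R xs ! k) = 0"
    using assms(2) by (intro coords_eq_0_imp_eq_0 homogeneous_sum_scaleR) auto
qed

lemma dim_range_eq_codim_left_kernel:
  fixes D :: "'v::euclidean_space \<Rightarrow> 'w::euclidean_space"
  assumes "linear D"
  shows "dim (range D) + dim {c. \<forall>v. c \<bullet> D v = 0} = DIM('w)"
proof -
  have "dim {y \<in> UNIV. \<forall>x\<in>range D. orthogonal x y} + dim (range D) = dim (UNIV :: 'w set)"
    using assms by (intro dim_subspace_orthogonal_to_vectors linear_subspace_image) auto
  then show ?thesis
    by (simp add: orthogonal_def inner_commute add.commute)
qed


section \<open>The differentials of the invariants\<close>

text \<open>
  The rows of the matrix \<open>J(h)\<close>: row \<open>i\<close> lists the coefficients of \<open>dH\<^sub>i\<close> in (S2) with respect to the ordered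
  coframing \<open>\<omega>\<^sup>0, \<omega>b\<^sup>0, \<gamma>, \<omega>\<^sup>1, \<omega>\<^sup>2, \<omega>\<^sup>3, \<omega>\<^sup>4\<close>.
\<close>

definition dH_coeffs :: "real \<Rightarrow> real \<times> real \<times> real \<times> real \<Rightarrow> nat \<Rightarrow> real list" where
  "dH_coeffs \<epsilon> = (\<lambda>(h1, h2, h3, h4) i.
     if i = 1 then
       [- (h2 - 1) / 2, - (h1 - \<epsilon> * h2 / h1) / 2, 2 * h1 * (h3 - \<epsilon> * h4), 0,
        - (h1 / 2 * (\<epsilon> * h2 * h4 + 3 * \<epsilon> * h4 - 3 * h2 * h3 - 3 * h2 - h3 + 3)), 0,
        - (h1 / 2 * (h1\<^sup>2 / h2 * (3 * h4 + 3 * \<epsilon> - \<epsilon> * h3) + (\<epsilon> * h4 - 3 * h3 - 3)))]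
     else if i = 2 then
       [h2 * (1 - h2) / h1, 0, 4 * h2 * (h3 + 1), 0,
        - (h2 * (\<epsilon> * h2 * h4 - \<epsilon> * h4 - 3 * h2 * h3 - 3 * h2 - h3 - 1)), 0, 4 * h2 * (h3 + 1)]
     else if i = 3 then
       [h3 * (h3 + 1) / h1, h2 * (h3 + 1) * (h4 + \<epsilon>) / h1\<^sup>2,
        - ((6 * \<epsilon> * h4 - 3 * h3\<^sup>2 + 3 * h4\<^sup>2 - 4 * h3 + 3) * (h3 + 1)),
        - ((h3 + 1) * (3/4 + \<epsilon> * h2 / (4 * h1\<^sup>2))),
        - ((h3 + 1) * (3 * h4 - \<epsilon> * h3 + 3 * \<epsilon>) * (h4 + \<epsilon>)),
        (3 * h2 * h3 + 4 * h2 + h3) / (4 * h1),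
        - (h3 * (h3 + 1) * (\<epsilon> * h4 - 3 * h3 - 3))]
     else
       [(h3 + 1) * (h4 + \<epsilon>) / h1, h2 * h4 * (h4 + \<epsilon>) / h1\<^sup>2,
        - ((4 * \<epsilon> * h4 - 3 * h3\<^sup>2 + 3 * h4\<^sup>2 - 6 * h3 - 3) * (h4 + \<epsilon>)),
        - (3 * h4 / 4 + \<epsilon> * h2 * h4 / (4 * h1\<^sup>2) + \<epsilon>),
        - (h4 * (3 * \<epsilon> * h4 - h3 + 3) * (\<epsilon> * h4 + 1)),
        (h4 + \<epsilon>) * (3 * h2 + 1) / (4 * h1),
        - ((h3 + 1) * (h4 + \<epsilon>) * (\<epsilon> * h4 - 3 * h3 - 3))])"

text \<open>
  The \<open>k\<close>-th entry of the row vector \<open>c J(h)\<close>. If \<open>c\<close> is the gradient of a function of \<open>h\<close>, these entries are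
  the coefficients of its differential in the coframing.
\<close>

definition apply_dH :: "real \<Rightarrow> real \<times> real \<times> real \<times> real \<Rightarrow> real \<times> real \<times> real \<times> real \<Rightarrow> nat \<Rightarrow> real" where
  "apply_dH \<epsilon> h = (\<lambda>(c1, c2, c3, c4) k. c1 * dH_coeffs \<epsilon> h 1 ! k + c2 * dH_coeffs \<epsilon> h 2 ! k +
     c3 * dH_coeffs \<epsilon> h 3 ! k + c4 * dH_coeffs \<epsilon> h 4 ! k)"

definition left_kernel :: "real \<Rightarrow> real \<times> real \<times> real \<times> real \<Rightarrow> (real \<times> real \<times> real \<times> real) set" where
  "left_kernel \<epsilon> h = {c. \<forall>k<7. apply_dH \<epsilon> h c k = 0}"

text \<open>
  The obstruction to rank 4: \<open>16 H\<^sub>1\<^sup>3\<close> times the minor of \<open>J(h)\<close> in the rows \<open>dH\<^sub>3\<close>, \<open>dH\<^sub>4\<close> and the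
  columns \<open>\<omega>\<^sup>1\<close>, \<open>\<omega>\<^sup>3\<close>.
\<close>

definition Delta :: "real \<Rightarrow> real \<times> real \<times> real \<times> real \<Rightarrow> real" where
  "Delta \<epsilon> = (\<lambda>(h1, h2, h3, h4). \<epsilon> * (3 * h2 * h3 + h3 + 4 * h2) * (h1\<^sup>2 - \<epsilon> * h2)
     + (\<epsilon> * h2 + 3 * h1\<^sup>2) * (h4 + \<epsilon>) * (h2 - 1))"

text \<open>
  The partial derivatives of \<open>\<Delta>\<close>, simplified with \<open>\<epsilon>\<^sup>2 = 1\<close>.
\<close>

definition grad_Delta :: "real \<Rightarrow> real \<times> real \<times> real \<times> real \<Rightarrow> real \<times> real \<times> real \<times> real" where
  "grad_Delta \<epsilon> = (\<lambda>(h1, h2, h3, h4).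
     (2 * h1 * (\<epsilon> * (3 * h2 * h3 + h3 + 4 * h2) + 3 * (h4 + \<epsilon>) * (h2 - 1)),
      \<epsilon> * (3 * h3 + 4) * (h1\<^sup>2 - \<epsilon> * h2) - (3 * h2 * h3 + h3 + 4 * h2)
        + \<epsilon> * (h4 + \<epsilon>) * (h2 - 1) + (\<epsilon> * h2 + 3 * h1\<^sup>2) * (h4 + \<epsilon>),
      \<epsilon> * (3 * h2 + 1) * (h1\<^sup>2 - \<epsilon> * h2),
      (\<epsilon> * h2 + 3 * h1\<^sup>2) * (h2 - 1)))"

text \<open>
  The coefficients of the 1-form \<open>\<lambda>\<close> with \<open>d\<Delta> = \<Delta> \<lambda>\<close>. In the variables \<open>a\<close>, \<open>b\<close> and \<open>r\<close> they are found by
  dividing \<open>d\<Delta>\<close> by \<open>\<Delta>\<close> on the slices \<open>a = 0\<close>, \<open>b = 0\<close> and \<open>h2 = 1\<close>, where \<open>\<Delta>\<close> factors.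
\<close>

definition Delta_multipliers :: "real \<Rightarrow> real \<times> real \<times> real \<times> real \<Rightarrow> real list" where
  "Delta_multipliers \<epsilon> = (\<lambda>(h1, h2, h3, h4). let a = h3 + 1; b = \<epsilon> * h4 + 1; r = \<epsilon> * h1\<^sup>2 / h2 in
     [(a + 1 - 2 * h2) / h1, -1 + \<epsilon> * h2 * b / h1\<^sup>2, 3 * a\<^sup>2 - 3 * b\<^sup>2 - b + 5 * a,
      - (3 * h1\<^sup>2 + \<epsilon> * h2) / (4 * h1\<^sup>2), 6 * h2 * a + 2 * h2 + a - 1 + a * b - 3 * b\<^sup>2 - 2 * h2 * b,
      (3 * h2 + 1) / (4 * h1), (a - 1) * r + 3 * a\<^sup>2 + 5 * a - a * b - 3 * r * b])"

lemma all_less_7: "(\<forall>k<7::nat. P k) \<longleftrightarrow> P 0 \<and> P 1 \<and> P 2 \<and> P 3 \<and> P 4 \<and> P 5 \<and> P 6"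
  by (simp add: eval_nat_numeral All_less_Suc conj_ac)

lemma sum_less_7: "(\<Sum>k<7. f k) = f 0 + f 1 + f 2 + f 3 + f 4 + f 5 + f (6::nat)"
  for f :: "nat \<Rightarrow> 'a::comm_monoid_add"
  by (simp add: eval_nat_numeral)

lemma nth_7:
  "[a0,a1,a2,a3,a4,a5,a6] ! 0 = a0" "[a0,a1,a2,a3,a4,a5,a6] ! 1 = a1" "[a0,a1,a2,a3,a4,a5,a6] ! 2 = a2"
  "[a0,a1,a2,a3,a4,a5,a6] ! 3 = a3" "[a0,a1,a2,a3,a4,a5,a6] ! 4 = a4" "[a0,a1,a2,a3,a4,a5,a6] ! 5 = a5"
  "[a0,a1,a2,a3,a4,a5,a6] ! 6 = a6"
  by (simp_all add: numeral_eq_Suc)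

lemma dH_coeffs_row:
  "dH_coeffs \<epsilon> (h1, h2, h3, h4) 1 =
    [- (h2 - 1) / 2, - (h1 - \<epsilon> * h2 / h1) / 2, 2 * h1 * (h3 - \<epsilon> * h4), 0,
     - (h1 / 2 * (\<epsilon> * h2 * h4 + 3 * \<epsilon> * h4 - 3 * h2 * h3 - 3 * h2 - h3 + 3)), 0,
     - (h1 / 2 * (h1\<^sup>2 / h2 * (3 * h4 + 3 * \<epsilon> - \<epsilon> * h3) + (\<epsilon> * h4 - 3 * h3 - 3)))]"
  "dH_coeffs \<epsilon> (h1, h2, h3, h4) 2 =
    [h2 * (1 - h2) / h1, 0, 4 * h2 * (h3 + 1), 0,
     - (h2 * (\<epsilon> * h2 * h4 - \<epsilon> * h4 - 3 * h2 * h3 - 3 * h2 - h3 - 1)), 0, 4 * h2 * (h3 + 1)]"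
  "dH_coeffs \<epsilon> (h1, h2, h3, h4) 3 =
    [h3 * (h3 + 1) / h1, h2 * (h3 + 1) * (h4 + \<epsilon>) / h1\<^sup>2,
     - ((6 * \<epsilon> * h4 - 3 * h3\<^sup>2 + 3 * h4\<^sup>2 - 4 * h3 + 3) * (h3 + 1)),
     - ((h3 + 1) * (3/4 + \<epsilon> * h2 / (4 * h1\<^sup>2))),
     - ((h3 + 1) * (3 * h4 - \<epsilon> * h3 + 3 * \<epsilon>) * (h4 + \<epsilon>)),
     (3 * h2 * h3 + 4 * h2 + h3) / (4 * h1),
     - (h3 * (h3 + 1) * (\<epsilon> * h4 - 3 * h3 - 3))]"
  "dH_coeffs \<epsilon> (h1, h2, h3, h4) 4 =
    [(h3 + 1) * (h4 + \<epsilon>) / h1, h2 * h4 * (h4 + \<epsilon>) / h1\<^sup>2,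
     - ((4 * \<epsilon> * h4 - 3 * h3\<^sup>2 + 3 * h4\<^sup>2 - 6 * h3 - 3) * (h4 + \<epsilon>)),
     - (3 * h4 / 4 + \<epsilon> * h2 * h4 / (4 * h1\<^sup>2) + \<epsilon>),
     - (h4 * (3 * \<epsilon> * h4 - h3 + 3) * (\<epsilon> * h4 + 1)),
     (h4 + \<epsilon>) * (3 * h2 + 1) / (4 * h1),
     - ((h3 + 1) * (h4 + \<epsilon>) * (\<epsilon> * h4 - 3 * h3 - 3))]"
  by (simp_all add: dH_coeffs_def)

text \<open>
  The identity \<open>d\<Delta> = \<Delta> \<lambda>\<close>, column by column. It has two uses: \<open>grad_Delta\<close> lies in the left kernel where
  \<open>\<Delta> = 0\<close>, and \<open>\<Delta>\<close> vanishes everywhere or nowhere.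
\<close>

lemma Delta_differential:
  assumes e: "\<epsilon> = 1 \<or> \<epsilon> = -1" and h: "h1 \<noteq> 0" "h2 \<noteq> 0" and k: "k < 7"
  shows "apply_dH \<epsilon> (h1, h2, h3, h4) (grad_Delta \<epsilon> (h1, h2, h3, h4)) k =
    Delta \<epsilon> (h1, h2, h3, h4) * Delta_multipliers \<epsilon> (h1, h2, h3, h4) ! k"
proof -
  note defs = all_less_7 apply_dH_def grad_Delta_def Delta_def Delta_multipliers_def Let_def
    prod.case dH_coeffs_row nth_7
  have "\<forall>k<7. apply_dH \<epsilon> (h1, h2, h3, h4) (grad_Delta \<epsilon> (h1, h2, h3, h4)) k =
    Delta \<epsilon> (h1, h2, h3, h4) * Delta_multipliers \<epsilon> (h1, h2, h3, h4) ! k"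
    using e
  proof
    assume "\<epsilon> = 1"
    show ?thesis
      unfolding defs \<open>\<epsilon> = 1\<close>
      apply (intro conjI)
      subgoal by (simp add: h divide_simps) algebra
      subgoal by (simp add: h divide_simps) algebra
      subgoal by algebra
      subgoal by (simp add: h divide_simps) algebra
      subgoal by algebra
      subgoal by (simp add: h divide_simps) algebra
      subgoal by (simp add: h divide_simps) algebra
      done
  next
    assume "\<epsilon> = -1"
    show ?thesis
      unfolding defs \<open>\<epsilon> = -1\<close>
      apply (intro conjI)
      subgoal by (simp add: h divide_simps) algebra
      subgoal by (simp add: h divide_simps) algebra
      subgoal by algebra
      subgoal by (simp add: h divide_simps) algebra
      subgoal by algebra
      subgoal by (simp add: h divide_simps) algebra
      subgoal by (simp add: h divide_simps) algebra
      done
  qed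
  then show ?thesis using k by blast
qed

lemma has_derivative_Delta:
  "(Delta \<epsilon> has_derivative (\<lambda>v. grad_Delta \<epsilon> h \<bullet> v)) (at h)" if "\<epsilon> * \<epsilon> = 1"
proof -
  obtain h1 h2 h3 h4 where h: "h = (h1, h2, h3, h4)"
    by (metis surj_pair)
  show ?thesis
    unfolding Delta_def case_prod_beta grad_Delta_def h
    by (rule derivative_eq_intros refl | simp)+
      (use that in \<open>auto simp: fun_eq_iff inner_prod_def, algebra\<close>)
qed


section \<open>The left kernel of the coefficient matrix\<close>

lemma left_kernel_iff:
  "(c1, c2, c3, c4) \<in> left_kernel \<epsilon> h \<longleftrightarrow>
    (\<forall>k<7. c1 * dH_coeffs \<epsilon> h 1 ! k + c2 * dH_coeffs \<epsilon> h 2 ! k +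
      c3 * dH_coeffs \<epsilon> h 3 ! k + c4 * dH_coeffs \<epsilon> h 4 ! k = 0)"
  by (simp add: left_kernel_def apply_dH_def)

lemma subspace_left_kernel: "subspace (left_kernel \<epsilon> h)"
proof -
  have "apply_dH \<epsilon> h (c + d) k = apply_dH \<epsilon> h c k + apply_dH \<epsilon> h d k"
    "apply_dH \<epsilon> h (t *\<^sub>R c) k = t * apply_dH \<epsilon> h c k" "apply_dH \<epsilon> h 0 k = 0" for c d t k
    by (cases c; cases d; simp add: apply_dH_def zero_prod_def algebra_simps)+
  then show ?thesis
    by (simp add: subspace_def left_kernel_def)
qed

text \<open>
  The equations of the left kernel in the columns \<open>\<omega>\<^sup>0\<close>, \<open>\<omega>b\<^sup>0\<close>, \<open>\<omega>\<^sup>1\<close>, \<open>\<omega>\<^sup>3\<close> and \<open>\<gamma>\<close>, cleared of denominators.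
  They already determine the kernel. The first two coefficients drop out of the equations of \<open>\<omega>\<^sup>1\<close> and
  \<open>\<omega>\<^sup>3\<close>; that of \<open>\<gamma>\<close> is stated for relations between \<open>dH\<^sub>1\<close> and \<open>dH\<^sub>2\<close>, where it is decisive if
  \<open>h1\<^sup>2 = \<epsilon> h2\<close>.
\<close>

lemma left_kernel_equations:
  assumes h: "h1 \<noteq> 0" "h2 \<noteq> 0" and c: "(c1, c2, c3, c4) \<in> left_kernel \<epsilon> (h1, h2, h3, h4)"
  shows "(h2 - 1) * (h1 * c1 + 2 * h2 * c2) = 2 * (h3 + 1) * (h3 * c3 + (h4 + \<epsilon>) * c4)"
    and "h1 * (h1\<^sup>2 - \<epsilon> * h2) * c1 = 2 * h2 * (h4 + \<epsilon>) * ((h3 + 1) * c3 + h4 * c4)"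
    and "(h3 + 1) * (3 * h1\<^sup>2 + \<epsilon> * h2) * c3 + (h4 * (3 * h1\<^sup>2 + \<epsilon> * h2) + 4 * \<epsilon> * h1\<^sup>2) * c4 = 0"
    and "(3 * h2 * h3 + 4 * h2 + h3) * c3 + (h4 + \<epsilon>) * (3 * h2 + 1) * c4 = 0"
    and "c3 = 0 \<Longrightarrow> c4 = 0 \<Longrightarrow> h1 * (h3 - \<epsilon> * h4) * c1 + 2 * h2 * (h3 + 1) * c2 = 0"
proof -
  note c = c[unfolded left_kernel_iff dH_coeffs_row all_less_7 nth_7]
  let ?x1 = "c1 * (- (h2 - 1) / 2) + c2 * (h2 * (1 - h2) / h1) + c3 * (h3 * (h3 + 1) / h1)
      + c4 * ((h3 + 1) * (h4 + \<epsilon>) / h1)"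
  have zero1: "?x1 = 0"
    using c by (elim conjE)
  have "(h2 - 1) * (h1 * c1 + 2 * h2 * c2) - 2 * (h3 + 1) * (h3 * c3 + (h4 + \<epsilon>) * c4) = ?x1 * (- (2 * h1))"
    using h by (simp add: field_simps)
  then show "(h2 - 1) * (h1 * c1 + 2 * h2 * c2) = 2 * (h3 + 1) * (h3 * c3 + (h4 + \<epsilon>) * c4)"
    unfolding zero1 by simp
  let ?x2 = "c1 * (- (h1 - \<epsilon> * h2 / h1) / 2) + c2 * 0 + c3 * (h2 * (h3 + 1) * (h4 + \<epsilon>) / h1\<^sup>2)
      + c4 * (h2 * h4 * (h4 + \<epsilon>) / h1\<^sup>2)"
  have zero2: "?x2 = 0"
    using c by (elim conjE)
  have "h1 * (h1\<^sup>2 - \<epsilon> * h2) * c1 - 2 * h2 * (h4 + \<epsilon>) * ((h3 + 1) * c3 + h4 * c4) = ?x2 * (- (2 * h1\<^sup>2))"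
    using h by (simp add: field_simps power2_eq_square)
  then show "h1 * (h1\<^sup>2 - \<epsilon> * h2) * c1 = 2 * h2 * (h4 + \<epsilon>) * ((h3 + 1) * c3 + h4 * c4)"
    unfolding zero2 by simp
  let ?x3 = "c1 * 0 + c2 * 0 + c3 * - ((h3 + 1) * (3/4 + \<epsilon> * h2 / (4 * h1\<^sup>2)))
      + c4 * - (3 * h4 / 4 + \<epsilon> * h2 * h4 / (4 * h1\<^sup>2) + \<epsilon>)"
  have zero3: "?x3 = 0"
    using c by (elim conjE)
  have "(h3 + 1) * (3 * h1\<^sup>2 + \<epsilon> * h2) * c3 + (h4 * (3 * h1\<^sup>2 + \<epsilon> * h2) + 4 * \<epsilon> * h1\<^sup>2) * c4 = ?x3 * (- (4 * h1\<^sup>2))"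
    using h by (simp add: field_simps)
  then show "(h3 + 1) * (3 * h1\<^sup>2 + \<epsilon> * h2) * c3 + (h4 * (3 * h1\<^sup>2 + \<epsilon> * h2) + 4 * \<epsilon> * h1\<^sup>2) * c4 = 0"
    unfolding zero3 by simp
  let ?x4 = "c1 * 0 + c2 * 0 + c3 * ((3 * h2 * h3 + 4 * h2 + h3) / (4 * h1))
      + c4 * ((h4 + \<epsilon>) * (3 * h2 + 1) / (4 * h1))"
  have zero4: "?x4 = 0"
    using c by (elim conjE)
  have "(3 * h2 * h3 + 4 * h2 + h3) * c3 + (h4 + \<epsilon>) * (3 * h2 + 1) * c4 = ?x4 * (4 * h1)"
    using h by (simp add: field_simps)
  then show "(3 * h2 * h3 + 4 * h2 + h3) * c3 + (h4 + \<epsilon>) * (3 * h2 + 1) * c4 = 0"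
    unfolding zero4 by simp
  assume "c3 = 0" "c4 = 0"
  moreover have "c1 * (2 * h1 * (h3 - \<epsilon> * h4)) + c2 * (4 * h2 * (h3 + 1))
      + c3 * - ((6 * \<epsilon> * h4 - 3 * h3\<^sup>2 + 3 * h4\<^sup>2 - 4 * h3 + 3) * (h3 + 1))
      + c4 * - ((4 * \<epsilon> * h4 - 3 * h3\<^sup>2 + 3 * h4\<^sup>2 - 6 * h3 - 3) * (h4 + \<epsilon>)) = 0"
    using c by (elim conjE)
  ultimately show "h1 * (h3 - \<epsilon> * h4) * c1 + 2 * h2 * (h3 + 1) * c2 = 0"
    by (simp add: algebra_simps)
qed

context
  fixes \<epsilon> h1 h2 h3 h4 :: real
  assumes e: "\<epsilon> = 1 \<or> \<epsilon> = -1" and h1: "h1 > 0" "h1\<^sup>2 \<noteq> \<epsilon>" and h2: "h2 \<noteq> 0"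
begin

private abbreviation "K \<equiv> left_kernel \<epsilon> (h1, h2, h3, h4)"

private lemma e2: "\<epsilon> * \<epsilon> = 1" and h1_nz: "h1 \<noteq> 0"
  using e h1 by auto

text \<open>
  Off the two loci the rows of \<open>dH\<^sub>1\<close> and \<open>dH\<^sub>2\<close> are independent. If \<open>h1\<^sup>2 \<noteq> \<epsilon> h2\<close>, the column of \<open>\<omega>b\<^sup>0\<close> kills
  \<open>c1\<close>, and \<open>dH\<^sub>2\<close> vanishes on the first locus only. If \<open>h1\<^sup>2 = \<epsilon> h2\<close>, then \<open>h2 \<noteq> 1\<close> because of \<open>h1\<^sup>2 \<noteq> \<epsilon>\<close>,
  and the minor in the columns of \<open>\<omega>\<^sup>0\<close> and \<open>\<gamma>\<close> is a nonzero multiple of \<open>h4 + \<epsilon>\<close>.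
\<close>

lemma left_kernel_trivial:
  assumes c: "(c1, c2, 0, 0) \<in> K"
    and "\<not> (h2 = 1 \<and> h3 = -1)" "\<not> (h2 = \<epsilon> * h1\<^sup>2 \<and> h4 = - \<epsilon>)"
  shows "c1 = 0 \<and> c2 = 0"
proof -
  note eqs = left_kernel_equations[OF h1_nz h2 c, simplified]
  show ?thesis
  proof (cases "h1\<^sup>2 = \<epsilon> * h2")
    case False
    then have "c1 = 0"
      using eqs(2) h1_nz by simp
    then show ?thesis
      using eqs(1,5) h2 assms(2) by (auto simp: eq_neg_iff_add_eq_0)
  next
    case True
    then have u: "h2 = \<epsilon> * h1\<^sup>2"
      using e2 by (metis mult.assoc mult_1)
    then have "h2 \<noteq> 1"
      using True h1 e by auto
    then have c1: "h1 * c1 = - 2 * h2 * c2"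
      using eqs(1) by auto
    have "h4 + \<epsilon> \<noteq> 0"
      using assms(3) u by (auto simp: eq_neg_iff_add_eq_0)
    have "h1 * (h3 - \<epsilon> * h4) * c1 + 2 * h2 * (h3 + 1) * c2 = 2 * \<epsilon> * h2 * (h4 + \<epsilon>) * c2"
      using c1 e2 by algebra
    then have "c2 = 0"
      using eqs(5) h2 \<open>h4 + \<epsilon> \<noteq> 0\<close> e by auto
    then show ?thesis
      using c1 h1_nz by simp
  qed
qed

text \<open>
  By Cramer's rule in the columns of \<open>\<omega>\<^sup>1\<close> and \<open>\<omega>\<^sup>3\<close>, the last two components of a kernel element are
  annihilated by \<open>\<Delta>\<close>.
\<close>

lemma left_kernel_if_Delta_nonzero:
  assumes "Delta \<epsilon> (h1, h2, h3, h4) \<noteq> 0"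
  shows "K = {0}"
proof -
  have "c = 0" if c: "c \<in> K" for c
  proof -
    obtain c1 c2 c3 c4 where c_eq: "c = (c1, c2, c3, c4)"
      by (metis surj_pair)
    note eqs = left_kernel_equations(3,4)[OF h1_nz h2 c[unfolded c_eq]]
    have "Delta \<epsilon> (h1, h2, h3, h4) * c3 = 0" "Delta \<epsilon> (h1, h2, h3, h4) * c4 = 0"
      using eqs e2 unfolding Delta_def prod.case by algebra+
    then have c34: "c3 = 0" "c4 = 0"
      using assms by auto
    have "\<not> (h2 = 1 \<and> h3 = -1)" "\<not> (h2 = \<epsilon> * h1\<^sup>2 \<and> h4 = - \<epsilon>)"
      using assms e by (auto simp: Delta_def algebra_simps)
    then show ?thesis
      using left_kernel_trivial[of c1 c2] c c34 by (simp add: c_eq zero_prod_def)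
  qed
  moreover have "0 \<in> K"
    by (simp add: left_kernel_def apply_dH_def zero_prod_def)
  ultimately show ?thesis by blast
qed

lemma grad_Delta_in_left_kernel:
  assumes "Delta \<epsilon> (h1, h2, h3, h4) = 0"
  shows "grad_Delta \<epsilon> (h1, h2, h3, h4) \<in> K"
  using Delta_differential[OF e h1_nz h2] assms by (simp add: left_kernel_def)

text \<open>
  The two expressions are the last two components of \<open>grad_Delta\<close>. They vanish together only at
  \<open>h2 = -1/3\<close>, \<open>h1\<^sup>2 = \<epsilon> / 9\<close>, where \<open>\<Delta> = -16/27\<close>; the other candidate, \<open>h1\<^sup>2 = \<epsilon> h2\<close> and \<open>h2 = 1\<close>, is
  excluded by \<open>h1\<^sup>2 \<noteq> \<epsilon>\<close>.
\<close>

lemma grad_Delta_nonzero: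
  assumes "Delta \<epsilon> (h1, h2, h3, h4) = 0"
  shows "\<epsilon> * (3 * h2 + 1) * (h1\<^sup>2 - \<epsilon> * h2) \<noteq> 0 \<or> (\<epsilon> * h2 + 3 * h1\<^sup>2) * (h2 - 1) \<noteq> 0"
proof (rule ccontr)
  assume "\<not> ?thesis"
  then have z: "(3 * h2 + 1) * (h1\<^sup>2 - \<epsilon> * h2) = 0" "(\<epsilon> * h2 + 3 * h1\<^sup>2) * (h2 - 1) = 0"
    using e by auto
  show False
  proof (cases "h1\<^sup>2 = \<epsilon> * h2")
    case True
    then have "\<epsilon> * h2 + 3 * h1\<^sup>2 = 4 * h1\<^sup>2"
      by simp
    then have "\<epsilon> * h2 + 3 * h1\<^sup>2 \<noteq> 0"
      using h1_nz by simp
    then have "h2 = 1"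
      using z(2) by simp
    then show False
      using True h1(2) by simp
  next
    case False
    then have u: "h2 = -1/3"
      using z(1) by simp
    then have h1_sq: "h1\<^sup>2 = \<epsilon> / 9"
      using z(2) by simp
    have "Delta \<epsilon> (h1, h2, h3, h4) = - (16 / 27) * (\<epsilon> * \<epsilon>)"
      unfolding Delta_def prod.case u h1_sq by (simp add: field_simps)
    then show False
      using assms e2 by simp
  qed
qed

text \<open>
  The columns of \<open>\<omega>\<^sup>1\<close> and \<open>\<omega>\<^sup>3\<close> give equations for the last two components of a kernel element; their
  coefficients are all 0 on the first locus at most, so these two components are proportional to those of \<open>grad_Delta\<close>.
  Subtracting a multiple of \<open>grad_Delta\<close> leaves a kernel element whose last two components are 0, which is
  0 by the independence of the rows of \<open>dH\<^sub>1\<close> and \<open>dH\<^sub>2\<close>.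
\<close>

lemma left_kernel_if_Delta_zero:
  assumes D: "Delta \<epsilon> (h1, h2, h3, h4) = 0"
    and n1: "\<not> (h2 = 1 \<and> h3 = -1)" and n2: "\<not> (h2 = \<epsilon> * h1\<^sup>2 \<and> h4 = - \<epsilon>)"
  shows "K = range (\<lambda>t. t *\<^sub>R grad_Delta \<epsilon> (h1, h2, h3, h4))"
proof -
  define g where "g = grad_Delta \<epsilon> (h1, h2, h3, h4)"
  obtain g1 g2 g3 g4 where g_eq: "g = (g1, g2, g3, g4)"
    by (metis surj_pair)
  have g_K: "(g1, g2, g3, g4) \<in> K"
    using grad_Delta_in_left_kernel[OF D] by (simp flip: g_def g_eq)
  have g34: "g3 \<noteq> 0 \<or> g4 \<noteq> 0"
    using grad_Delta_nonzero[OF D] g_def[unfolded g_eq] by (simp add: grad_Delta_def)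
  note g_eqs = left_kernel_equations(3,4)[OF h1_nz h2 g_K]
  have "\<exists>t. c = t *\<^sub>R g" if c: "c \<in> K" for c
  proof -
    obtain c1 c2 c3 c4 where c_eq: "c = (c1, c2, c3, c4)"
      by (metis surj_pair)
    note c_K = c[unfolded c_eq]
    note c_eqs = left_kernel_equations(3,4)[OF h1_nz h2 c_K]
    have proportional: "c3 * g4 - c4 * g3 = 0"
    proof (rule ccontr)
      assume nz: "c3 * g4 - c4 * g3 \<noteq> 0"
      have "(h3 + 1) * (3 * h1\<^sup>2 + \<epsilon> * h2) * (c3 * g4 - c4 * g3) = 0"
        "(h4 * (3 * h1\<^sup>2 + \<epsilon> * h2) + 4 * \<epsilon> * h1\<^sup>2) * (c3 * g4 - c4 * g3) = 0"
        "(3 * h2 * h3 + 4 * h2 + h3) * (c3 * g4 - c4 * g3) = 0"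
        using c_eqs g_eqs by algebra+
      then have z: "(h3 + 1) * (3 * h1\<^sup>2 + \<epsilon> * h2) = 0"
        "h4 * (3 * h1\<^sup>2 + \<epsilon> * h2) + 4 * \<epsilon> * h1\<^sup>2 = 0" "3 * h2 * h3 + 4 * h2 + h3 = 0"
        using nz by auto
      have "3 * h1\<^sup>2 + \<epsilon> * h2 \<noteq> 0"
        using z(2) h1_nz e by auto
      then have "h3 = -1"
        using z(1) by auto
      then show False
        using z(3) n1 by simp
    qed
    have red: "c = t *\<^sub>R g" if t: "c3 = t * g3" "c4 = t * g4" for t
    proof -
      have "(c1 - t * g1, c2 - t * g2, 0, 0) \<in> K"
        using subspace_diff[OF subspace_left_kernel c_K subspace_scale[OF subspace_left_kernel g_K, of t]] t
        by (simp add: zero_prod_def)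
      from left_kernel_trivial[OF this n1 n2] show ?thesis
        using t by (simp add: c_eq g_eq)
    qed
    show ?thesis
    proof (cases "g3 = 0")
      case True
      then have "c3 = c4 / g4 * g3" "c4 = c4 / g4 * g4"
        using proportional g34 by auto
      then show ?thesis using red by blast
    next
      case False
      then have "c3 = c3 / g3 * g3" "c4 = c3 / g3 * g4"
        using proportional by (auto simp: field_simps)
      then show ?thesis using red by blast
    qed
  qed
  moreover have "t *\<^sub>R g \<in> K" for t
    using subspace_scale[OF subspace_left_kernel g_K] by (simp add: g_eq)
  ultimately show ?thesis
    unfolding g_def by blast
qed

text \<open>
  Here \<open>dH\<^sub>2 = dH\<^sub>3 = 0\<close>, and \<open>dH\<^sub>1\<close>, \<open>dH\<^sub>4\<close> are independent because \<open>h1\<^sup>2 \<noteq> \<epsilon>\<close>.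
\<close>

lemma left_kernel_first_locus:
  assumes "h2 = 1" "h3 = -1"
  shows "K = range (\<lambda>(x, y). (0, x, y, 0))"
proof -
  have q: "h1\<^sup>2 - \<epsilon> * h2 \<noteq> 0"
    using assms h1 by simp
  have "c1 = 0 \<and> c4 = 0" if c: "(c1, c2, c3, c4) \<in> K" for c1 c2 c3 c4
  proof -
    note eqs = left_kernel_equations(2-4)[OF h1_nz h2 c, unfolded assms, simplified]
    have "4 * (h1\<^sup>2 - \<epsilon> * h2) * c4 = 0"
      using eqs(2,3) e2 assms by algebra
    then have "c4 = 0" using q by simp
    then show ?thesis
      using eqs(1) q assms h1_nz by simp
  qed
  moreover have "(0, x, y, 0) \<in> K" for x y
    unfolding left_kernel_iff all_less_7 dH_coeffs_row nth_7 assms by simp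
  ultimately show ?thesis by force
qed

text \<open>
  Here \<open>dH\<^sub>4 = 0\<close> and \<open>dH\<^sub>2 = 2 \<epsilon> H\<^sub>1 dH\<^sub>1\<close>, the differential of the relation \<open>H\<^sub>2 = \<epsilon> H\<^sub>1\<^sup>2\<close>.
\<close>

lemma left_kernel_second_locus:
  assumes "h2 = \<epsilon> * h1\<^sup>2" "h4 = - \<epsilon>"
  shows "K = range (\<lambda>(x, y). (- 2 * \<epsilon> * h1 * x, x, 0, y))"
proof -
  have s: "h2 \<noteq> 1"
    using assms h1 e by auto
  have "c1 = - 2 * \<epsilon> * h1 * c2 \<and> c3 = 0" if c: "(c1, c2, c3, c4) \<in> K" for c1 c2 c3 c4
  proof -
    note eqs = left_kernel_equations(1,3,4)[OF h1_nz h2 c]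
    have "4 * h1\<^sup>2 * ((h3 + 1) * c3) = 0" 
      using eqs(2) e2 assms by algebra
    then have z: "(h3 + 1) * c3 = 0"
      using h1_nz by simp
    moreover have "(h2 - 1) * c3 = 0"
      using z eqs(3) assms(2) by algebra
    ultimately have "c3 = 0"
      using s by simp
    moreover from this have "(h2 - 1) * (h1 * (c1 + 2 * \<epsilon> * h1 * c2)) = 0"
      using eqs(1) assms by algebra
    then have "c1 + 2 * \<epsilon> * h1 * c2 = 0"
      using s h1_nz by simp
    ultimately show ?thesis by linarith
  qed
  moreover have "(- 2 * \<epsilon> * h1 * x, x, 0, y) \<in> K" for x y
    using e
  proof
    assume "\<epsilon> = 1"
    show ?thesis
      unfolding left_kernel_iff all_less_7 dH_coeffs_row nth_7 assms \<open>\<epsilon> = 1\<close>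
      using h1_nz by (simp add: field_simps power2_eq_square)
  next
    assume "\<epsilon> = -1"
    show ?thesis
      unfolding left_kernel_iff all_less_7 dH_coeffs_row nth_7 assms \<open>\<epsilon> = -1\<close>
      using h1_nz by (simp add: field_simps power2_eq_square)
  qed
  ultimately show ?thesis by force
qed

lemma dim_left_kernel:
  "dim K = (if Delta \<epsilon> (h1, h2, h3, h4) \<noteq> 0 then 0
     else if h2 = 1 \<and> h3 = -1 \<or> h2 = \<epsilon> * h1\<^sup>2 \<and> h4 = - \<epsilon> then 2 else 1)"
proof -
  have dim2: "dim (range f) = 2" if "linear f" "inj f" for f :: "real \<times> real \<Rightarrow> real \<times> real \<times> real \<times> real"
    using dim_image_eq[of f UNIV] that by simp
  consider (nz) "Delta \<epsilon> (h1, h2, h3, h4) \<noteq> 0" | (first) "h2 = 1" "h3 = -1"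
    | (second) "h2 = \<epsilon> * h1\<^sup>2" "h4 = - \<epsilon>" 
    | (gen) "Delta \<epsilon> (h1, h2, h3, h4) = 0" "\<not> (h2 = 1 \<and> h3 = -1)" "\<not> (h2 = \<epsilon> * h1\<^sup>2 \<and> h4 = - \<epsilon>)"
    by blast
  then show ?thesis
  proof cases
    case nz
    then show ?thesis
      using left_kernel_if_Delta_nonzero by simp
  next
    case first
    then have "Delta \<epsilon> (h1, h2, h3, h4) = 0"
      by (simp add: Delta_def)
    moreover have "dim K = 2"
      unfolding left_kernel_first_locus[OF first]
      by (rule dim2) (auto intro!: linearI injI)
    ultimately show ?thesis using first by simp
  next
    case second
    then have "Delta \<epsilon> (h1, h2, h3, h4) = 0"
      using e by (auto simp: Delta_def)
    moreover have "dim K = 2"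
      unfolding left_kernel_second_locus[OF second]
      by (rule dim2) (auto intro!: linearI injI simp: algebra_simps)
    ultimately show ?thesis using second by simp
  next
    case gen
    have "grad_Delta \<epsilon> (h1, h2, h3, h4) \<noteq> 0"
      using grad_Delta_nonzero[OF gen(1)] by (auto simp: grad_Delta_def zero_prod_def)
    then have "inj (\<lambda>t. t *\<^sub>R grad_Delta \<epsilon> (h1, h2, h3, h4))"
      by (intro injI) simp
    then have "dim (range (\<lambda>t. t *\<^sub>R grad_Delta \<epsilon> (h1, h2, h3, h4))) = 1"
      using dim_image_eq[of "\<lambda>t. t *\<^sub>R grad_Delta \<epsilon> (h1, h2, h3, h4)" "UNIV :: real set"]
      by (auto intro!: linearI simp: scaleR_add_left)
    then show ?thesis
      using left_kernel_if_Delta_zero[OF gen] gen by auto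
  qed
qed

end


section \<open>The linear systems of the degeneracy loci\<close>

text \<open>
  The entry \<open>(i, j)\<close> lists the coefficients of the 1-form \<open>\<Lambda>\<^sub>i\<^sub>j\<close> in the system \<open>df\<^sub>i = f\<^sub>0 \<Lambda>\<^sub>i\<^sub>0 + f\<^sub>1 \<Lambda>\<^sub>i\<^sub>1\<close>
  for \<open>f\<^sub>0 = h2 - 1\<close>, \<open>f\<^sub>1 = h3 + 1\<close>. They come from (S2) by splitting
  \<open>3 h2 h3 + 4 h2 + h3 = (h3 + 1) (3 h2 + 1) + (h2 - 1)\<close> and
  \<open>\<epsilon> h2 h4 - \<epsilon> h4 - 3 h2 h3 - 3 h2 - h3 - 1 = (h2 - 1) \<epsilon> h4 - (h3 + 1) (3 h2 + 1)\<close>.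
\<close>

definition first_multipliers :: "real \<Rightarrow> nat \<Rightarrow> nat \<Rightarrow> real \<times> real \<times> real \<times> real \<Rightarrow> real list" where
  "first_multipliers \<epsilon> i j = (\<lambda>(h1, h2, h3, h4).
     if i = 0 then
       if j = 0 then [- h2 / h1, 0, 0, 0, - \<epsilon> * h2 * h4, 0, 0]
       else [0, 0, 4 * h2, 0, h2 * (3 * h2 + 1), 0, 4 * h2]
     else
       if j = 0 then [0, 0, 0, 0, 0, 1 / (4 * h1), 0]
       else [h3 / h1, h2 * (h4 + \<epsilon>) / h1\<^sup>2, - (6 * \<epsilon> * h4 - 3 * h3\<^sup>2 + 3 * h4\<^sup>2 - 4 * h3 + 3),
         - (3/4 + \<epsilon> * h2 / (4 * h1\<^sup>2)), - ((3 * h4 - \<epsilon> * h3 + 3 * \<epsilon>) * (h4 + \<epsilon>)),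
         (3 * h2 + 1) / (4 * h1), - (h3 * (\<epsilon> * h4 - 3 * h3 - 3))])"

text \<open>
  The analogous 1-forms for \<open>f\<^sub>0 = h1\<^sup>2 - \<epsilon> h2\<close>, \<open>f\<^sub>1 = h4 + \<epsilon>\<close>. As polynomials in \<open>f\<^sub>1\<close>, the coefficients of
  \<open>df\<^sub>0\<close> have degree at most 1 and constant terms divisible by \<open>f\<^sub>0\<close>; in \<open>df\<^sub>1\<close>, only the coefficient of \<open>\<omega>\<^sup>1\<close>
  is not a multiple of \<open>f\<^sub>1\<close>.
\<close>

definition second_multipliers :: "real \<Rightarrow> nat \<Rightarrow> nat \<Rightarrow> real \<times> real \<times> real \<times> real \<Rightarrow> real list" where
  "second_multipliers \<epsilon> i j = (\<lambda>(h1, h2, h3, h4).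
     if i = 0 then
       if j = 0 then [- (h2 - 1) / h1, -1, 4 * (h3 + 1), 0, (h3 + 1) * (3 * h2 + 1) + h2 - 1, 0,
         \<epsilon> * h3 * h1\<^sup>2 / h2 + 4 * (h3 + 1)]
       else [0, 0, - 4 * \<epsilon> * h1\<^sup>2, 0, h2 * (h2 - 1) - \<epsilon> * h1\<^sup>2 * (h2 + 3), 0,
         - \<epsilon> * h1\<^sup>2 * (3 * \<epsilon> * h1\<^sup>2 / h2 + 1)]
     else
       if j = 0 then [0, 0, 0, - \<epsilon> / (4 * h1\<^sup>2), 0, 0, 0]
       else [(h3 + 1) / h1, h2 * h4 / h1\<^sup>2, - (4 * \<epsilon> * h4 - 3 * h3\<^sup>2 + 3 * h4\<^sup>2 - 6 * h3 - 3),
         - (3 * h1\<^sup>2 + \<epsilon> * h2) / (4 * h1\<^sup>2), - (\<epsilon> * h4 * (3 * \<epsilon> * h4 - h3 + 3)),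
         (3 * h2 + 1) / (4 * h1), - ((h3 + 1) * (\<epsilon> * h4 - 3 * h3 - 3))])"

lemma first_locus_differential:
  assumes h: "h1 \<noteq> 0" "h2 \<noteq> 0" and k: "k < 7"
  shows "apply_dH \<epsilon> (h1, h2, h3, h4) (0, 1, 0, 0) k =
      (h2 - 1) * first_multipliers \<epsilon> 0 0 (h1, h2, h3, h4) ! k
      + (h3 + 1) * first_multipliers \<epsilon> 0 1 (h1, h2, h3, h4) ! k" (is "?P k")
    and "apply_dH \<epsilon> (h1, h2, h3, h4) (0, 0, 1, 0) k =
      (h2 - 1) * first_multipliers \<epsilon> 1 0 (h1, h2, h3, h4) ! k
      + (h3 + 1) * first_multipliers \<epsilon> 1 1 (h1, h2, h3, h4) ! k" (is "?Q k")
proof -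
  have "\<forall>k<7. ?P k \<and> ?Q k"
    unfolding all_less_7 apply_dH_def prod.case dH_coeffs_row nth_7
    using h by (simp add: first_multipliers_def field_simps)
  then show "?P k" "?Q k" using k by blast+
qed

lemma second_locus_differential:
  assumes e: "\<epsilon> = 1 \<or> \<epsilon> = -1" and h: "h1 \<noteq> 0" "h2 \<noteq> 0" and k: "k < 7"
  shows "apply_dH \<epsilon> (h1, h2, h3, h4) (2 * h1, - \<epsilon>, 0, 0) k =
      (h1\<^sup>2 - \<epsilon> * h2) * second_multipliers \<epsilon> 0 0 (h1, h2, h3, h4) ! k
      + (h4 + \<epsilon>) * second_multipliers \<epsilon> 0 1 (h1, h2, h3, h4) ! k" (is "?P k")
    and "apply_dH \<epsilon> (h1, h2, h3, h4) (0, 0, 0, 1) k =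
      (h1\<^sup>2 - \<epsilon> * h2) * second_multipliers \<epsilon> 1 0 (h1, h2, h3, h4) ! k
      + (h4 + \<epsilon>) * second_multipliers \<epsilon> 1 1 (h1, h2, h3, h4) ! k" (is "?Q k")
proof -
  have "\<forall>k<7. ?P k \<and> ?Q k"
    using e
  proof
    assume "\<epsilon> = 1"
    show ?thesis
      unfolding all_less_7 apply_dH_def prod.case dH_coeffs_row nth_7 \<open>\<epsilon> = 1\<close>
      using h by (simp add: second_multipliers_def field_simps power2_eq_square)
  next
    assume "\<epsilon> = -1"
    show ?thesis
      unfolding all_less_7 apply_dH_def prod.case dH_coeffs_row nth_7 \<open>\<epsilon> = -1\<close>
      using h by (simp add: second_multipliers_def field_simps power2_eq_square)
  qed
  then show "?P k" "?Q k" using k by blast+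
qed

text \<open>
  The region where the coefficients of all these systems are continuous.
\<close>

definition invariant_space :: "(real \<times> real \<times> real \<times> real) set" where
  "invariant_space = {(h1, h2, h3, h4). h1 > 0 \<and> h2 \<noteq> 0}"

lemma continuous_on_Delta_multipliers:
  "k < 7 \<Longrightarrow> continuous_on invariant_space (\<lambda>h. Delta_multipliers \<epsilon> h ! k)"
proof -
  have "\<forall>k<7. continuous_on invariant_space (\<lambda>h. Delta_multipliers \<epsilon> h ! k)"
    unfolding Delta_multipliers_def case_prod_beta Let_def all_less_7 nth_7
    by (intro conjI continuous_intros) (auto simp: invariant_space_def)
  then show "k < 7 \<Longrightarrow> continuous_on invariant_space (\<lambda>h. Delta_multipliers \<epsilon> h ! k)"
    by blast
qed

lemma continuous_on_first_multipliers:
  "k < 7 \<Longrightarrow> continuous_on invariant_space (\<lambda>h. first_multipliers \<epsilon> i j h ! k)"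
proof -
  have "\<forall>k<7. continuous_on invariant_space (\<lambda>h. first_multipliers \<epsilon> i j h ! k)"
    unfolding first_multipliers_def case_prod_beta all_less_7
    by (cases "i = 0"; cases "j = 0"; simp only: simp_thms if_True if_False nth_7;
        intro conjI continuous_intros; auto simp: invariant_space_def)
  then show "k < 7 \<Longrightarrow> continuous_on invariant_space (\<lambda>h. first_multipliers \<epsilon> i j h ! k)"
    by blast
qed

lemma continuous_on_second_multipliers:
  "k < 7 \<Longrightarrow> continuous_on invariant_space (\<lambda>h. second_multipliers \<epsilon> i j h ! k)"
proof -
  have "\<forall>k<7. continuous_on invariant_space (\<lambda>h. second_multipliers \<epsilon> i j h ! k)"
    unfolding second_multipliers_def case_prod_beta all_less_7
    by (cases "i = 0"; cases "j = 0"; simp only: simp_thms if_True if_False nth_7;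
        intro conjI continuous_intros; auto simp: invariant_space_def)
  then show "k < 7 \<Longrightarrow> continuous_on invariant_space (\<lambda>h. second_multipliers \<epsilon> i j h ! k)"
    by blast
qed


section \<open>Constancy of the rank and cohomogeneity\<close>

text \<open>
  The part of the canonical coframing that determines the rank of \<open>(H\<^sub>1, \<dots>, H\<^sub>4)\<close>: independent 1-forms and
  invariants subject to (S2).
\<close>

locale canonical_coframing =
  fixes X :: "('n::{t2_space,second_countable_topology}, 7, 'm, 'k, 5) baecklund_data"
    and \<epsilon> :: real and \<omega> :: "nat \<Rightarrow> ('n, 7) form" and \<omega>b \<gamma> :: "('n, 7) form"
    and H :: "nat \<Rightarrow> 'n \<Rightarrow> real"
  assumes connected: "connected (UNIV :: 'n set)"
    and manifold: "smooth_manifold (AN X)"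
    and one_forms: "\<And>i. i \<le> 4 \<Longrightarrow> \<omega> i \<in> kforms (AN X) UNIV 1" "\<omega>b \<in> kforms (AN X) UNIV 1"
      "\<gamma> \<in> kforms (AN X) UNIV 1"
    and coframing: "\<And>z. z \<in> pts (AN X) UNIV \<Longrightarrow>
      dim {\<omega> 0 z, \<omega>b z, \<gamma> z, \<omega> 1 z, \<omega> 2 z, \<omega> 3 z, \<omega> 4 z} = 7"
    and epsilon: "\<epsilon> = 1 \<or> \<epsilon> = -1"
    and H1_pos: "\<And>p. H 1 p > 0" and H1_square: "\<And>p. (H 1 p)\<^sup>2 \<noteq> \<epsilon>" and H2_nonzero: "\<And>p. H 2 p \<noteq> 0"
    and smooth_H: "\<And>i. i \<in> {1..4} \<Longrightarrow> smooth_fun (AN X) (H i)"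
    and S2: "structure_equations_S2 X \<epsilon> \<omega> \<omega>b \<gamma> H"
begin

definition coframe :: "('n, 7) pt \<Rightarrow> 7 ext list" where
  "coframe z = [\<omega> 0 z, \<omega>b z, \<gamma> z, \<omega> 1 z, \<omega> 2 z, \<omega> 3 z, \<omega> 4 z]"

lemma length_coframe: "length (coframe z) = 7"
  by (simp add: coframe_def)

definition invs :: "'n \<Rightarrow> real \<times> real \<times> real \<times> real" where
  "invs p = (H 1 p, H 2 p, H 3 p, H 4 p)"

lemma invs_in_invariant_space: "invs p \<in> invariant_space"
  using H1_pos H2_nonzero by (simp add: invs_def invariant_space_def)

lemma coframe_kforms: "k < 7 \<Longrightarrow> (\<lambda>z. coframe z ! k) \<in> kforms (AN X) UNIV 1"
  using one_forms unfolding coframe_def by (auto simp: less_Suc_eq eval_nat_numeral)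

lemma ext_d_H:
  assumes "z \<in> pts (AN X) UNIV" "i \<in> {1..4}"
  shows "ext_d (fun_form (H i)) z = (\<Sum>k<7. dH_coeffs \<epsilon> (invs (base z)) i ! k *\<^sub>R coframe z ! k)"
proof -
  have "i = 1 \<or> i = 2 \<or> i = 3 \<or> i = 4"
    using assms(2) by auto
  moreover have "- r / 2 = - (1/2 * r)" for r :: real
    by simp
  ultimately show ?thesis
    using S2[unfolded structure_equations_S2_def Let_def, rule_format, OF assms(1)]
    unfolding invs_def coframe_def sum_less_7
    by (elim disjE conjE)
      (simp_all only: dH_coeffs_row nth_7 scaleR_minus_left scaleR_add_right scaleR_zero_left add_0
        add_0_right diff_conv_add_uminus add_ac minus_minus)
qed

lemma chart_point: "z \<in> pts (AN X) UNIV \<longleftrightarrow> fst z \<in> AN X \<and> snd z \<in> snd (fst z) ` fst (fst z)"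
  by (cases z) (auto simp: pts_def)

abbreviation coframe_on :: "('n, 7) pt \<Rightarrow> real ^ 7 \<Rightarrow> nat \<Rightarrow> real" where
  "coframe_on z v k \<equiv> coords (coframe z ! k) \<bullet> v"

lemma has_derivative_H:
  assumes "z \<in> pts (AN X) UNIV" "i \<in> {1..4}"
  shows "((H i \<circ> chart_inv (fst z)) has_derivative
    (\<lambda>v. \<Sum>k<7. dH_coeffs \<epsilon> (invs (base z)) i ! k * coframe_on z v k)) (at (snd z))"
proof -
  have "(H i \<circ> chart_inv (fst z)) differentiable (at (snd z))"
    using smooth_H[OF assms(2)] assms(1) unfolding chart_point smooth_fun_def
    by (blast intro: smooth_on_imp_differentiable)
  from has_derivative_ext_d_fun_form[OF this] show ?thesis
    by (simp add: ext_d_H[OF assms] linear_sum[OF linear_coords] linear_cmul[OF linear_coords]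
        inner_sum_left)
qed

text \<open>
  The derivative of a function of \<open>h\<close> with gradient \<open>c\<close> is obtained by contracting \<open>c\<close> with \<open>D\<close>; both the rank
  and the linear systems of the loci are read off from this formula.
\<close>

lemma has_derivative_invs:
  assumes "z \<in> pts (AN X) UNIV"
  shows "\<exists>D. ((invs \<circ> chart_inv (fst z)) has_derivative D) (at (snd z)) \<and>
    (\<forall>c v. c \<bullet> D v = (\<Sum>k<7. apply_dH \<epsilon> (invs (base z)) c k * coframe_on z v k))"
proof (intro exI conjI allI)
  let ?d = "\<lambda>i v. \<Sum>k<7. dH_coeffs \<epsilon> (invs (base z)) i ! k * coframe_on z v k"
  show "((invs \<circ> chart_inv (fst z)) has_derivative (\<lambda>v. (?d 1 v, ?d 2 v, ?d 3 v, ?d 4 v))) (at (snd z))"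
  proof -
    have "invs \<circ> chart_inv (fst z) = (\<lambda>x. ((H 1 \<circ> chart_inv (fst z)) x, (H 2 \<circ> chart_inv (fst z)) x,
        (H 3 \<circ> chart_inv (fst z)) x, (H 4 \<circ> chart_inv (fst z)) x))"
      by (simp add: invs_def o_def)
    then show ?thesis
      by (simp only:) (intro has_derivative_Pair has_derivative_H[OF assms]; simp)
  qed
  show "c \<bullet> (?d 1 v, ?d 2 v, ?d 3 v, ?d 4 v) =
      (\<Sum>k<7. apply_dH \<epsilon> (invs (base z)) c k * coframe_on z v k)" for c v
    by (cases c) (simp add: apply_dH_def distrib_right sum.distrib sum_distrib_left mult.assoc)
qed

text \<open>
  Rank-nullity for the transpose: since the coframing is independent, a covector that annihilates the
  image of the derivative annihilates each column of \<open>J(h)\<close>.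
\<close>

lemma map_rank_invs:
  assumes "z \<in> pts (AN X) UNIV"
  shows "map_rank invs z + dim (left_kernel \<epsilon> (invs (base z))) = 4"
proof -
  obtain D where D: "((invs \<circ> chart_inv (fst z)) has_derivative D) (at (snd z))"
    and inner_D: "\<And>c v. c \<bullet> D v = (\<Sum>k<7. apply_dH \<epsilon> (invs (base z)) c k * coframe_on z v k)"
    using has_derivative_invs[OF assms] by blast
  have rank: "map_rank invs z = dim (range D)"
    using frechet_derivative_at[OF D] by (simp add: map_rank_def)
  have "(\<forall>v. c \<bullet> D v = 0) \<longleftrightarrow> (\<forall>k<7. apply_dH \<epsilon> (invs (base z)) c k = 0)" for c
  proof
    assume "\<forall>v. c \<bullet> D v = 0"
    then have "(\<Sum>k<7. apply_dH \<epsilon> (invs (base z)) c k *\<^sub>R coords (coframe z ! k)) \<bullet> v = 0" for v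
      by (simp add: inner_D inner_sum_left)
    then have "(\<Sum>k<7. apply_dH \<epsilon> (invs (base z)) c k *\<^sub>R coords (coframe z ! k)) = 0"
      using inner_eq_zero_iff by blast
    then have zero:
      "(\<Sum>k<length (coframe z). apply_dH \<epsilon> (invs (base z)) c k *\<^sub>R coords (coframe z ! k)) = 0"
      by (simp only: length_coframe)
    show "\<forall>k<7. apply_dH \<epsilon> (invs (base z)) c k = 0"
    proof (intro allI impI)
      fix k :: nat
      assume k: "k < 7"
      show "apply_dH \<epsilon> (invs (base z)) c k = 0"
      proof (rule coords_independent[OF _ _ zero])
        show "dim (set (coframe z)) = length (coframe z)"
          using coframing[OF assms] by (simp add: coframe_def)
        show "homogeneous 1 \<xi>" if "\<xi> \<in> set (coframe z)" for \<xi>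
          using that one_forms assms by (auto simp: coframe_def kforms_def)
        show "k < length (coframe z)"
          using k by (simp only: length_coframe)
      qed
    qed
  qed (simp add: inner_D)
  then have "{c. \<forall>v. c \<bullet> D v = 0} = left_kernel \<epsilon> (invs (base z))"
    by (simp add: left_kernel_def)
  with dim_range_eq_codim_left_kernel[OF has_derivative_linear[OF D]] show ?thesis
    by (simp add: rank)
qed

text \<open>
  The transfer from \<open>h\<close> to \<open>N\<close>: a linear system that holds algebraically for functions of \<open>h\<close>, modulo (S2),
  becomes a linear differential system on \<open>N\<close>.
\<close>

lemma zero_locus_everywhere_or_nowhere:
  fixes F :: "nat \<Rightarrow> real \<times> real \<times> real \<times> real \<Rightarrow> real"
  assumes J: "finite J"
    and grad: "\<And>i h. i \<in> J \<Longrightarrow> (F i has_derivative (\<lambda>v. G i h \<bullet> v)) (at h)"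
    and lin: "\<And>i k h. i \<in> J \<Longrightarrow> k < 7 \<Longrightarrow> h \<in> invariant_space \<Longrightarrow>
      apply_dH \<epsilon> h (G i h) k = (\<Sum>j\<in>J. F j h * a i j h ! k)"
    and cont: "\<And>i j k. i \<in> J \<Longrightarrow> j \<in> J \<Longrightarrow> k < 7 \<Longrightarrow> continuous_on invariant_space (\<lambda>h. a i j h ! k)"
    and zero: "\<And>i. i \<in> J \<Longrightarrow> F i (invs p) = 0" and i: "i \<in> J"
  shows "F i (invs q) = 0"
proof -
  let ?L = "\<lambda>i j z. \<Sum>k<7. a i j (invs (base z)) ! k *\<^sub>R coords (coframe z ! k)"
  show ?thesis
  proof (rule common_zeros_everywhere_or_nowhere[OF manifold connected J, where f = "\<lambda>i p. F i (invs p)"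
        and L = ?L and p = p and k = i])
    fix i j :: nat and c :: "('n, 7) chart"
    assume i: "i \<in> J" and c: "c \<in> AN X"
    show "((\<lambda>p. F i (invs p)) \<circ> chart_inv c has_derivative
        (\<lambda>v. \<Sum>j\<in>J. F j (invs (chart_inv c x)) * (?L i j (c, x) \<bullet> v))) (at x)"
      if x: "x \<in> snd c ` fst c" for x
    proof -
      have z: "(c, x) \<in> pts (AN X) UNIV"
        using c x by (simp add: chart_point)
      obtain D where D: "((invs \<circ> chart_inv c) has_derivative D) (at x)"
        and inner_D: "\<And>e v. e \<bullet> D v = (\<Sum>k<7. apply_dH \<epsilon> (invs (chart_inv c x)) e k * coframe_on (c, x) v k)"
        using has_derivative_invs[OF z] by (auto simp: base_def)
      have "G i (invs (chart_inv c x)) \<bullet> D v =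
          (\<Sum>j\<in>J. F j (invs (chart_inv c x)) * (?L i j (c, x) \<bullet> v))" for v
      proof -
        have "G i (invs (chart_inv c x)) \<bullet> D v =
            (\<Sum>k<7. \<Sum>j\<in>J. F j (invs (chart_inv c x)) * a i j (invs (chart_inv c x)) ! k
              * coframe_on (c, x) v k)"
          unfolding inner_D
          by (intro sum.cong refl) (simp add: lin[OF i _ invs_in_invariant_space] sum_distrib_right)
        also have "\<dots> = (\<Sum>j\<in>J. \<Sum>k<7. F j (invs (chart_inv c x)) * a i j (invs (chart_inv c x)) ! k
              * coframe_on (c, x) v k)"
          by (rule sum.swap)
        finally show ?thesis
          by (simp add: base_def inner_sum_left sum_distrib_left mult.assoc)
      qed
      then show ?thesis
        using has_derivative_compose[OF D grad[OF i]] by (simp add: o_def)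
    qed
    show "continuous_on (snd c ` fst c) (\<lambda>x. ?L i j (c, x))" if j: "j \<in> J"
    proof (intro continuous_on_sum continuous_on_scaleR)
      fix k :: nat
      assume "k \<in> {..<7}"
      then have k: "k < 7" by simp
      have "continuous_on (snd c ` fst c) (H i \<circ> chart_inv c)" if "i \<in> {1..4}" for i
        using smooth_H[OF that] c unfolding smooth_fun_def by (blast intro: smooth_on_imp_continuous_on)
      then have "continuous_on (snd c ` fst c) (invs \<circ> chart_inv c)"
        unfolding invs_def o_def by (intro continuous_on_Pair) auto
      then have "continuous_on (snd c ` fst c) (\<lambda>x. a i j ((invs \<circ> chart_inv c) x) ! k)"
        by (rule continuous_on_compose2[OF cont[OF i j k]]) (auto simp: invs_in_invariant_space)
      then show "continuous_on (snd c ` fst c) (\<lambda>x. a i j (invs (base (c, x))) ! k)"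
        by (simp add: base_def)
      have "\<forall>S. smooth_on (snd c ` fst c) (\<lambda>x. coframe (c, x) ! k $ S)"
        using coframe_kforms[OF k] c by (simp add: kforms_def forms_def)
      then show "continuous_on (snd c ` fst c) (\<lambda>x. coords (coframe (c, x) ! k))"
        unfolding coords_def by (intro continuous_on_vec_lambda) (blast intro: smooth_on_imp_continuous_on)
    qed
  qed (use zero i in auto)
qed

lemma Delta_everywhere_or_nowhere:
  assumes "Delta \<epsilon> (invs p) = 0"
  shows "Delta \<epsilon> (invs q) = 0"
proof (rule zero_locus_everywhere_or_nowhere[where F = "\<lambda>_. Delta \<epsilon>" and J = "{0}" and p = p and i = 0
      and G = "\<lambda>_. grad_Delta \<epsilon>" and a = "\<lambda>_ _. Delta_multipliers \<epsilon>"])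
  show "apply_dH \<epsilon> h (grad_Delta \<epsilon> h) k = (\<Sum>j\<in>{0::nat}. Delta \<epsilon> h * Delta_multipliers \<epsilon> h ! k)"
    if "k < 7" "h \<in> invariant_space" for k h
    using that Delta_differential[OF epsilon] by (auto simp: invariant_space_def)
  show "continuous_on invariant_space (\<lambda>h. Delta_multipliers \<epsilon> h ! k)" if "k < 7" for k
    using that by (rule continuous_on_Delta_multipliers)
qed (use epsilon assms in \<open>auto intro: has_derivative_Delta\<close>)

definition on_first_locus :: "'n \<Rightarrow> bool" where
  "on_first_locus p \<longleftrightarrow> H 2 p = 1 \<and> H 3 p = -1"

definition on_second_locus :: "'n \<Rightarrow> bool" where
  "on_second_locus p \<longleftrightarrow> H 2 p = \<epsilon> * (H 1 p)\<^sup>2 \<and> H 4 p = - \<epsilon>"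

lemma first_locus_everywhere_or_nowhere:
  assumes "on_first_locus p"
  shows "on_first_locus q"
proof -
  let ?F = "\<lambda>i::nat. \<lambda>(h1::real, h2, h3, h4::real). if i = 0 then h2 - 1 else h3 + 1 :: real"
  let ?G = "\<lambda>i::nat. \<lambda>_. if i = 0 then (0, 1, 0, 0) else (0, 0, 1, 0) :: real \<times> real \<times> real \<times> real"
  have "?F i (invs q) = 0" if "i \<in> {0, 1}" for i
  proof (rule zero_locus_everywhere_or_nowhere[where F = ?F and G = ?G and J = "{0, 1}" and p = p
        and a = "first_multipliers \<epsilon>"])
    show "(?F i has_derivative (\<lambda>v. ?G i h \<bullet> v)) (at h)" for i h
      by (auto simp: case_prod_beta inner_prod_def intro!: derivative_eq_intros)
    show "apply_dH \<epsilon> h (?G i h) k = (\<Sum>j\<in>{0, 1}. ?F j h * first_multipliers \<epsilon> i j h ! k)"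
      if "i \<in> {0, 1}" "k < 7" "h \<in> invariant_space" for i k h
      using that first_locus_differential by (auto simp: invariant_space_def)
    show "?F i (invs p) = 0" for i
      using assms by (simp add: on_first_locus_def invs_def)
  qed (use that in \<open>auto intro: continuous_on_first_multipliers\<close>)
  from this[of 0] this[of 1] show ?thesis
    by (simp add: on_first_locus_def invs_def)
qed

lemma second_locus_everywhere_or_nowhere:
  assumes "on_second_locus p"
  shows "on_second_locus q"
proof -
  let ?F = "\<lambda>i::nat. \<lambda>(h1, h2, h3::real, h4). if i = 0 then h1\<^sup>2 - \<epsilon> * h2 else h4 + \<epsilon>"
  let ?G = "\<lambda>i::nat. \<lambda>(h1, _::real, _::real, _::real).
    if i = 0 then (2 * h1, - \<epsilon>, 0, 0) else (0, 0, 0, 1 :: real)"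
  have locus: "on_second_locus p \<longleftrightarrow> ?F 0 (invs p) = 0 \<and> ?F 1 (invs p) = 0" for p
    using epsilon by (auto simp: on_second_locus_def invs_def)
  have "?F i (invs q) = 0" if "i \<in> {0, 1}" for i
  proof (rule zero_locus_everywhere_or_nowhere[where F = ?F and G = ?G and J = "{0, 1}" and p = p
        and a = "second_multipliers \<epsilon>"])
    show "(?F i has_derivative (\<lambda>v. ?G i h \<bullet> v)) (at h)" for i h
      by (auto simp: case_prod_beta inner_prod_def intro!: derivative_eq_intros)
    show "apply_dH \<epsilon> h (?G i h) k = (\<Sum>j\<in>{0, 1}. ?F j h * second_multipliers \<epsilon> i j h ! k)"
      if "i \<in> {0, 1}" "k < 7" "h \<in> invariant_space" for i k h
      using that second_locus_differential[OF epsilon] by (auto simp: invariant_space_def)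
    show "?F i (invs p) = 0" if "i \<in> {0, 1}" for i
      using assms that unfolding locus by blast
  qed (use that in \<open>auto intro: continuous_on_second_multipliers\<close>)
  from this[of 0] this[of 1] show ?thesis
    unfolding locus by blast
qed

lemma map_rank_eq:
  assumes "z \<in> pts (AN X) UNIV"
  shows "map_rank invs z = (if Delta \<epsilon> (invs (base z)) \<noteq> 0 then 4
    else if on_first_locus (base z) \<or> on_second_locus (base z) then 2 else 3)"
proof -
  have "dim (left_kernel \<epsilon> (invs (base z))) = (if Delta \<epsilon> (invs (base z)) \<noteq> 0 then 0
      else if on_first_locus (base z) \<or> on_second_locus (base z) then 2 else 1)"
    unfolding on_first_locus_def on_second_locus_def invs_def
    by (rule dim_left_kernel[OF epsilon H1_pos H1_square H2_nonzero])
  with map_rank_invs[OF assms] show ?thesis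
    by (auto split: if_splits)
qed

lemma all_pts_iff: "(\<forall>z\<in>pts (AN X) UNIV. P (base z)) \<longleftrightarrow> (\<forall>p. P p)"
proof
  assume P: "\<forall>z\<in>pts (AN X) UNIV. P (base z)"
  show "\<forall>p. P p"
  proof
    fix p
    obtain c where c: "c \<in> AN X" "p \<in> fst c"
      using manifold unfolding smooth_manifold_def by blast
    then have "(c, snd c p) \<in> pts (AN X) UNIV"
      by (simp add: pts_def)
    moreover have "base (c, snd c p) = p"
      using smooth_manifold_chart(5)[OF manifold c] by (simp add: base_def)
    ultimately show "P p"
      using P by metis
  qed
qed blast

lemma of_cohomogeneity_iff:
  "of_cohomogeneity X H n \<longleftrightarrow> (\<forall>p. n = (if Delta \<epsilon> (invs p) \<noteq> 0 then 4
    else if on_first_locus p \<or> on_second_locus p then 2 else 3))"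
proof -
  have "of_cohomogeneity X H n \<longleftrightarrow> (\<forall>z\<in>pts (AN X) UNIV. map_rank invs z = n)"
    by (simp add: of_cohomogeneity_def invs_def[abs_def])
  also have "\<dots> \<longleftrightarrow> (\<forall>z\<in>pts (AN X) UNIV. n = (if Delta \<epsilon> (invs (base z)) \<noteq> 0 then 4
      else if on_first_locus (base z) \<or> on_second_locus (base z) then 2 else 3))"
    by (intro ball_cong refl) (simp only: map_rank_eq eq_commute[of n])
  also have "\<dots> \<longleftrightarrow> (\<forall>p. n = (if Delta \<epsilon> (invs p) \<noteq> 0 then 4
      else if on_first_locus p \<or> on_second_locus p then 2 else 3))"
    by (rule all_pts_iff)
  finally show ?thesis .
qed

lemma Delta_on_loci: "on_first_locus p \<or> on_second_locus p \<Longrightarrow> Delta \<epsilon> (invs p) = 0"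
  using epsilon by (auto simp: on_first_locus_def on_second_locus_def invs_def Delta_def)

text \<open>
  The vanishing of \<open>\<Delta>\<close> and membership in each locus have truth values \<open>d\<close>, \<open>f\<close>, \<open>s\<close> that do not depend on
  the point, so the three equivalences become propositional. As \<open>N\<close> is a type, it has a point at which to
  read off these values.
\<close>

lemma cohomogeneity_classification:
  "of_cohomogeneity X H 2 \<longleftrightarrow> (\<forall>p. on_first_locus p) \<or> (\<forall>p. on_second_locus p)"
  "of_cohomogeneity X H 3 \<longleftrightarrow> (\<forall>p. Delta \<epsilon> (invs p) = 0) \<and> \<not> of_cohomogeneity X H 2"
  "of_cohomogeneity X H 4 \<longleftrightarrow> \<not> of_cohomogeneity X H 2 \<and> \<not> of_cohomogeneity X H 3"
proof -
  define d f s where "d \<longleftrightarrow> Delta \<epsilon> (invs undefined) = 0"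
    and "f \<longleftrightarrow> on_first_locus undefined" and "s \<longleftrightarrow> on_second_locus undefined"
  have everywhere: "Delta \<epsilon> (invs p) = 0 \<longleftrightarrow> d" "on_first_locus p \<longleftrightarrow> f" "on_second_locus p \<longleftrightarrow> s" for p
    unfolding d_def f_def s_def using Delta_everywhere_or_nowhere
      first_locus_everywhere_or_nowhere second_locus_everywhere_or_nowhere by blast+
  have "f \<or> s \<Longrightarrow> d"
    using Delta_on_loci[of undefined] by (simp add: everywhere)
  then show "of_cohomogeneity X H 2 \<longleftrightarrow> (\<forall>p. on_first_locus p) \<or> (\<forall>p. on_second_locus p)"
    "of_cohomogeneity X H 3 \<longleftrightarrow> (\<forall>p. Delta \<epsilon> (invs p) = 0) \<and> \<not> of_cohomogeneity X H 2"
    "of_cohomogeneity X H 4 \<longleftrightarrow> \<not> of_cohomogeneity X H 2 \<and> \<not> of_cohomogeneity X H 3"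
    unfolding of_cohomogeneity_iff everywhere by auto
qed

end

theorem theorem4p8:
  fixes X :: "('n::{t2_space,second_countable_topology}, 7,
      'm::{t2_space,second_countable_topology}, 'k::{t2_space,second_countable_topology}, 5)
      baecklund_data"
    and \<chi>10 \<chi>01 :: "('n, 7) pt \<Rightarrow> 7 ext set"
    and \<epsilon> :: real
    and \<omega> :: "nat \<Rightarrow> ('n, 7) form" and \<omega>b \<gamma> :: "('n, 7) form"
    and A K M0 Mb0 :: "'n \<Rightarrow> real" and C D P S H :: "nat \<Rightarrow> 'n \<Rightarrow> real"
  assumes "connected (UNIV :: 'n set)"
    and "type_A1 X \<chi>10 \<chi>01 \<epsilon>"
    and "one_adapted X \<chi>10 \<chi>01 \<epsilon> UNIV \<omega> \<omega>b \<gamma> A C D"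
    and "G1_structure_equations X \<epsilon> UNIV \<omega> \<omega>b \<gamma> A C D K P S"
    and "\<And>p. C 2 p \<noteq> 0" and "\<And>i p. i \<in> {1..4} \<Longrightarrow> S i p = 0"
    and "\<And>p. D 4 p = 1" and "\<And>p. K p = 1" and "\<And>p. C 1 p = 0" and "\<And>p. D 3 p = 0"
    and "gamma_coefficients X \<omega> \<omega>b \<gamma> M0 Mb0"
    and "\<And>p. H 1 p = A p" and "\<And>p. H 2 p = A p * C 2 p"
    and "\<And>p. H 3 p = A p * M0 p" and "\<And>p. H 4 p = A p * Mb0 p / C 2 p"
    and "\<And>i. i \<in> {1..4} \<Longrightarrow> smooth_fun (AN X) (H i)"
    and "structure_equations_S1 X \<epsilon> \<omega> \<omega>b \<gamma> H"
    and "structure_equations_S2 X \<epsilon> \<omega> \<omega>b \<gamma> H"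
  shows "(of_cohomogeneity X H 2 \<longleftrightarrow>
        (\<forall>p. H 2 p = 1 \<and> H 3 p = -1) \<or> (\<forall>p. H 2 p = \<epsilon> * (H 1 p)\<^sup>2 \<and> H 4 p = - \<epsilon>)) \<and>
    (of_cohomogeneity X H 3 \<longleftrightarrow>
        (\<forall>p. \<epsilon> * (3 * H 2 p * H 3 p + H 3 p + 4 * H 2 p) * ((H 1 p)\<^sup>2 - \<epsilon> * H 2 p)
           = - ((\<epsilon> * H 2 p + 3 * (H 1 p)\<^sup>2) * (H 4 p + \<epsilon>) * (H 2 p - 1))) \<and>
        \<not> of_cohomogeneity X H 2) \<and>
    (of_cohomogeneity X H 4 \<longleftrightarrow> \<not> of_cohomogeneity X H 2 \<and> \<not> of_cohomogeneity X H 3)"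
proof -
  interpret canonical_coframing X \<epsilon> \<omega> \<omega>b \<gamma> H
  proof
    show "smooth_manifold (AN X)"
      using assms(2) by (simp add: type_A1_def type_A_def baecklund_def integrable_extension_def EDS_def)
    note adapted = assms(3)[unfolded one_adapted_def Let_def]
    show "\<omega> i \<in> kforms (AN X) UNIV 1" if "i \<le> 4" for i
      using adapted that by blast
    show "\<omega>b \<in> kforms (AN X) UNIV 1" "\<gamma> \<in> kforms (AN X) UNIV 1"
      using adapted by blast+
    show "dim {\<omega> 0 z, \<omega>b z, \<gamma> z, \<omega> 1 z, \<omega> 2 z, \<omega> 3 z, \<omega> 4 z} = 7" if "z \<in> pts (AN X) UNIV" for z
      using adapted that by blast
    show "\<epsilon> = 1 \<or> \<epsilon> = -1"
      using adapted by blast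
    have A: "A p > 0" "(A p)\<^sup>2 \<noteq> \<epsilon>" for p
      using adapted by blast+
    show "H 1 p > 0" "(H 1 p)\<^sup>2 \<noteq> \<epsilon>" "H 2 p \<noteq> 0" for p
      using A[of p] assms(5)[of p] assms(12,13) by auto
    show "smooth_fun (AN X) (H i)" if "i \<in> {1..4}" for i
      using assms(16) that .
  qed (use assms in blast)+
  have Delta: "Delta \<epsilon> (invs p) = 0 \<longleftrightarrow>
      \<epsilon> * (3 * H 2 p * H 3 p + H 3 p + 4 * H 2 p) * ((H 1 p)\<^sup>2 - \<epsilon> * H 2 p)
        = - ((\<epsilon> * H 2 p + 3 * (H 1 p)\<^sup>2) * (H 4 p + \<epsilon>) * (H 2 p - 1))" for p
    by (simp add: Delta_def invs_def eq_neg_iff_add_eq_0)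
  show ?thesis
    using cohomogeneity_classification unfolding on_first_locus_def on_second_locus_def Delta by blast
qed

end
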